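(* Assume that $F_1\le F_2\le\cdots\le F_k$ pointwise on $[0,\infty)$. For $i=1,\ldots,k$ let $c_i$ and $d_i$ be the left and right endpoints of the support of $F_i$, and assume that for every $i=1,\ldots,k-1$, $$\inf_{c_i+\eta\le t\le d_i-\eta}[F_j(t)-F_i(t)]>0\quad\text{for all }\eta>0\text{ and all } j>\max\{l: F_l\equiv F_i\}.$$ Suppose that for some $1\le i\le k$ and some $t$ with $0<F_i(t)<1$ the set $\mathcal S_{it}=\{j:F_j(t)=F_i(t)\}$ contains more than one element. Then $$P[\,|Z_i^*(t)|\le u\,]>P[\,|Z_i(t)|\le u\,]\quad\text{for all }u>0.$$
   Context: Competing risks model: $k\ge 3$ is fixed, $(T,\delta)$ is a random pair with $T\ge 0$ having a continuous distribution function $F$, and $\delta\in\{1,\ldots,k\}$. The cumulative incidence functions are $F_j(t)=P[T\le t,\ \delta=j]$, so $F=\sum_{j=1}^k F_j$. $(Z_1,\ldots,Z_k)^T$ is a $k$-variate mean-zero Gaussian process with covariance $\mathrm{Cov}(Z_i(s),Z_j(t))=F_i(s)[\delta_{ij}-F_j(t)]$ for $s\le t$, $1\le i,j\le k$, where $\delta_{ij}$ is the Kronecker delta (the weak limit of the normalized empirical cumulative incidence functions). With $i_*(t)=\min\mathcal S_{it}$ and $i^*(t)=\max\mathcal S_{it}$, $$Z_i^*(t)=\max_{i_*(t)\le r\le i}\ \min_{i\le s\le i^*(t)}\ \frac{\sum_{j=r}^{s}Z_j(t)}{s-r+1}$$ (the distributional limit of the normalized order-restricted estimator at $t$). *)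

theory Defs
  imports "HOL-Probability.Probability"
begin

text \<open>The risks are numbered $1, \dots, k$ by natural numbers.\<close>

locale competing_risks = prob_space M
  for M :: "'a measure" and T :: "'a \<Rightarrow> real" and \<delta> :: "'a \<Rightarrow> nat" and k :: nat +
  assumes k_ge_3: "k \<ge> 3"
    and T_measurable: "random_variable borel T"
    and T_nonneg: "\<And>\<omega>. \<omega> \<in> space M \<Longrightarrow> 0 \<le> T \<omega>"
    and \<delta>_measurable: "random_variable (count_space UNIV) \<delta>"
    and \<delta>_range: "\<And>\<omega>. \<omega> \<in> space M \<Longrightarrow> \<delta> \<omega> \<in> {1..k}"
    and continuous_df: "continuous_on UNIV (\<lambda>t. prob {\<omega> \<in> space M. T \<omega> \<le> t})"

definition cif :: "'a measure \<Rightarrow> ('a \<Rightarrow> real) \<Rightarrow> ('a \<Rightarrow> nat) \<Rightarrow> nat \<Rightarrow> real \<Rightarrow> real" where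
  "cif M T \<delta> j t = measure M {\<omega> \<in> space M. T \<omega> \<le> t \<and> \<delta> \<omega> = j}"

text \<open>
  The support of a nondecreasing function \<open>G\<close> is its set of points of increase, that is, the
  topological support of the measure it generates (for continuous \<open>G\<close>). The endpoints may be
  infinite, and if the support is empty (\<open>G\<close> constant), they are \<open>\<infinity>\<close> and \<open>- \<infinity>\<close>.
\<close>

definition df_support :: "(real \<Rightarrow> real) \<Rightarrow> real set" where
  "df_support G = {x. \<forall>\<epsilon>>0. G (x - \<epsilon>) < G (x + \<epsilon>)}"

definition left_endpoint :: "(real \<Rightarrow> real) \<Rightarrow> ereal" where
  "left_endpoint G = (INF x\<in>df_support G. ereal x)"

definition right_endpoint :: "(real \<Rightarrow> real) \<Rightarrow> ereal" where
  "right_endpoint G = (SUP x\<in>df_support G. ereal x)"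

text \<open>
  Normal variables may be degenerate, i.e. almost surely constant; this is needed because
  $Z_i(t)$ has variance $0$ whenever $F_i(t) \in \{0, 1\}$.
\<close>

definition gaussian_rv :: "'b measure \<Rightarrow> ('b \<Rightarrow> real) \<Rightarrow> bool" where
  "gaussian_rv N X \<longleftrightarrow>
     (X \<in> borel_measurable N \<and> (\<exists>\<mu>. AE \<omega> in N. X \<omega> = \<mu>)) \<or>
     (\<exists>\<mu> \<sigma>. \<sigma> > 0 \<and> distributed N lborel X (normal_density \<mu> \<sigma>))"

definition gaussian_family :: "'b measure \<Rightarrow> 'i set \<Rightarrow> ('i \<Rightarrow> 'b \<Rightarrow> real) \<Rightarrow> bool" where
  "gaussian_family N I X \<longleftrightarrow>
     (\<forall>J a. finite J \<longrightarrow> J \<subseteq> I \<longrightarrow> gaussian_rv N (\<lambda>\<omega>. \<Sum>j\<in>J. a j * X j \<omega>))"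

definition gaussian_process :: "'b measure \<Rightarrow> nat \<Rightarrow> (nat \<Rightarrow> real \<Rightarrow> 'b \<Rightarrow> real) \<Rightarrow> bool" where
  "gaussian_process N k Z \<longleftrightarrow> gaussian_family N ({1..k} \<times> {0..}) (\<lambda>(i, t). Z i t)"

definition cov :: "'b measure \<Rightarrow> ('b \<Rightarrow> real) \<Rightarrow> ('b \<Rightarrow> real) \<Rightarrow> real" where
  "cov N X Y =
     (LINT \<omega>|N. (X \<omega> - (LINT \<omega>'|N. X \<omega>')) * (Y \<omega> - (LINT \<omega>'|N. Y \<omega>')))"

definition tie_set :: "nat \<Rightarrow> (nat \<Rightarrow> real \<Rightarrow> real) \<Rightarrow> nat \<Rightarrow> real \<Rightarrow> nat set" where
  "tie_set k F i t = {j \<in> {1..k}. F j t = F i t}"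

definition Z_star :: "nat \<Rightarrow> (nat \<Rightarrow> real \<Rightarrow> real) \<Rightarrow> (nat \<Rightarrow> real \<Rightarrow> 'b \<Rightarrow> real) \<Rightarrow>
    nat \<Rightarrow> real \<Rightarrow> 'b \<Rightarrow> real" where
  "Z_star k F Z i t \<omega> =
     (MAX r\<in>{Min (tie_set k F i t)..i}. MIN s\<in>{i..Max (tie_set k F i t)}.
        (\<Sum>j=r..s. Z j t \<omega>) / (real s - real r + 1))"

end

theory Submission
  imports Defs
begin

text \<open>
  Fix \<open>t\<close> and write $X_j = Z_j(t)$. On the tie set, an interval of indices, the $X_j$ are exchangeable
  Gaussian variables, so the mean $A$ over any subinterval $[a,b]$ is independent of the deviations
  $X_j - A$. For a centred (possibly degenerate) Gaussian $A$ the probability $P[|A + v| \le u]$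
  decreases in $|v|$. Hence of two translation equivariant estimators the one that always lies closer
  to $A$ has the larger probability of being within $u$ of $0$. Starting from $X_i$, i.e. from the
  interval $[i,i]$, enlarge the interval by one index at a time: each time the max-min estimator does
  not move away from the mean over the new interval. The first enlargement, to a pair of indices,
  yields a strict inequality, because with positive probability the new estimator equals the mean while
  $X_i$ differs from it by more than $u$.
\<close>

section \<open>Independence from characteristic functions\<close>

text \<open>Levy uniqueness concerns probability laws, so the signed weight \<open>g\<close> is
  turned into the density \<open>h = 1 + g / K\<close>. It has total mass 1 because the case s = 0
  of \<open>null\<close> says that \<open>g\<close> integrates to 0. The law of \<open>Y\<close> is
  then the same under \<open>h\<close> as under \<open>M\<close>, and comparing the two on
  \<open>B\<close> gives the claim.\<close>

lemma (in prob_space) Fourier_null_real: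
  fixes g Y :: "'a \<Rightarrow> real"
  assumes [measurable]: "g \<in> borel_measurable M" "Y \<in> borel_measurable M" "B \<in> sets borel"
    and bdd: "\<And>x. \<bar>g x\<bar> \<le> C"
    and null: "\<And>s. (CLINT x|M. g x * iexp (s * Y x)) = 0"
  shows "(LINT x|M. g x * indicator B (Y x)) = 0"
proof -
  \<comment> \<open>The summand 1 keeps \<open>K\<close> positive even when \<open>C\<close> is 0,
    and \<open>K\<close> bounds the absolute value of \<open>g\<close>, so \<open>h\<close> takes
    values in [0, 2].\<close>
  define K where "K = \<bar>C\<bar> + 1"
  define h where "h x = 1 + g x / K" for x
  have K: "K > 0" "\<bar>g x\<bar> \<le> K" for x using bdd[of x] by (auto simp: K_def)
  have [measurable]: "h \<in> borel_measurable M" unfolding h_def by measurable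
  have h0: "0 \<le> h x" "\<bar>h x\<bar> \<le> 2" for x
    using K(1) K(2)[of x] by (auto simp: h_def field_simps abs_le_iff)
  have ig: "integrable M g" by (rule integrable_const_bound[of _ K]) (use K in auto)
  have ih: "integrable M h" by (rule integrable_const_bound[of _ 2]) (use h0 in auto)
  have ihe: "integrable M (\<lambda>x. complex_of_real (g x) * iexp (s * Y x))" for s
    by (rule integrable_const_bound[of _ K]) (use K in \<open>auto simp: norm_mult\<close>)
  have ie: "integrable M (\<lambda>x. iexp (s * Y x))" for s
    by (rule integrable_const_bound[of _ 1]) (auto simp: norm_mult)
  have g0: "(LINT x|M. g x) = 0"
    using null[of 0] by (simp add: integral_complex_of_real)
  have h1: "(LINT x|M. h x) = 1"
    unfolding h_def using ig g0 prob_space by simp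
  let ?D = "density M (\<lambda>x. ennreal (h x))"
  have "prob_space ?D"
    using ih h1 h0 by (intro prob_spaceI) (simp add: emeasure_density nn_integral_eq_integral cong: nn_integral_cong)
  then interpret D: prob_space ?D .
  have rD: "real_distribution (distr ?D borel Y)"
    by (rule D.real_distribution_distr) simp
  have rM: "real_distribution (distr M borel Y)"
    by (rule real_distribution_distr) simp
  \<comment> \<open>Reweighting \<open>M\<close> by \<open>h\<close> does not change the characteristic function of \<open>Y\<close>.\<close>
  have "char (distr ?D borel Y) s = char (distr M borel Y) s" for s
  proof -
    have "char (distr ?D borel Y) s = (CLINT x|M. h x *\<^sub>R iexp (s * Y x))"
      unfolding char_def using h0 by (subst integral_distr; simp add: integral_density)
    also have "\<dots> = (CLINT x|M. iexp (s * Y x) + (1/K) * (g x * iexp (s * Y x)))"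
      by (intro Bochner_Integration.integral_cong) (auto simp: h_def scaleR_conv_of_real field_simps)
    also have "\<dots> = (CLINT x|M. iexp (s * Y x))"
      using ie[of s] ihe[of s] null[of s] by (simp del: of_real_mult)
    finally show ?thesis unfolding char_def by (subst (2) integral_distr) simp_all
  qed
  then have eq: "distr ?D borel Y = distr M borel Y"
    using Levy_uniqueness[OF rD rM] by blast
  have "measure (distr ?D borel Y) B = (LINT x|?D. indicator B (Y x))"
    by (simp add: measure_distr indicator_vimage[symmetric] vimage_def)
  also have "\<dots> = (LINT x|M. h x * indicator B (Y x))"
    using h0 by (subst integral_density) auto
  also have "\<dots> = (LINT x|M. indicator B (Y x) + (1/K) * (g x * indicator B (Y x)))"
    by (intro Bochner_Integration.integral_cong) (auto simp: h_def field_simps)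
  also have "\<dots> = (LINT x|M. indicator B (Y x)) + (1/K) * (LINT x|M. g x * indicator B (Y x))"
  proof -
    have "integrable M (\<lambda>x. g x * indicator B (Y x))"
      by (rule integrable_const_bound[of _ K]) (use K in \<open>auto simp: indicator_def less_imp_le\<close>)
    moreover have "integrable M (\<lambda>x. indicator B (Y x) :: real)"
      by (rule integrable_const_bound[of _ 1]) (auto simp: indicator_def)
    ultimately show ?thesis by simp
  qed
  also have "(LINT x|M. indicator B (Y x)) = measure (distr M borel Y) B"
    by (simp add: measure_distr indicator_vimage[symmetric] vimage_def)
  finally show ?thesis using K(1) by (simp add: eq)
qed

text \<open>The real version applies to the real and imaginary parts of \<open>g\<close> once
  \<open>cnj (g x)\<close> is known to satisfy the same hypothesis, since both parts are linear
  combinations of \<open>g\<close> and its conjugate.\<close>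

lemma (in prob_space) Fourier_null:
  fixes g :: "'a \<Rightarrow> complex" and Y :: "'a \<Rightarrow> real"
  assumes [measurable]: "g \<in> borel_measurable M" "Y \<in> borel_measurable M" "B \<in> sets borel"
    and bdd: "\<And>x. norm (g x) \<le> C"
    and null: "\<And>s. (CLINT x|M. g x * iexp (s * Y x)) = 0"
  shows "(CLINT x|M. g x * indicator B (Y x)) = 0"
proof -
  have [measurable]: "(\<lambda>x. cnj (g x)) \<in> borel_measurable M"
    by (intro borel_measurable_continuous_on[OF _ assms(1)] continuous_intros)
  have C: "\<bar>Re (g x)\<bar> \<le> C" "\<bar>Im (g x)\<bar> \<le> C" for x
    using abs_Re_le_cmod[of "g x"] abs_Im_le_cmod[of "g x"] bdd[of x] by auto
  have ie: "integrable M (\<lambda>x. g x * iexp (s * Y x))" "integrable M (\<lambda>x. cnj (g x) * iexp (s * Y x))" for s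
    by (rule integrable_const_bound[of _ C]; use bdd in \<open>auto simp: norm_mult\<close>)+
  have cnj: "(CLINT x|M. cnj (g x) * iexp (s * Y x)) = 0" for s
  proof -
    \<comment> \<open>Conjugation reverses the frequency, so the hypothesis is used at
      \<open>-s\<close>.\<close>
    have "(CLINT x|M. cnj (g x) * iexp (s * Y x)) = (CLINT x|M. cnj (g x * iexp ((-s) * Y x)))"
      by (intro Bochner_Integration.integral_cong) (auto simp: exp_cnj)
    also have "\<dots> = cnj (CLINT x|M. g x * iexp ((-s) * Y x))"
      by (simp only: Bochner_Integration.integral_cnj)
    finally show ?thesis unfolding null by simp
  qed
  have "(CLINT x|M. complex_of_real (Re (g x)) * iexp (s * Y x)) =
      (CLINT x|M. (1/2) * (g x * iexp (s * Y x) + cnj (g x) * iexp (s * Y x)))" for s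
    by (intro Bochner_Integration.integral_cong)
       (auto simp: complex_add_cnj simp flip: distrib_right)
  note ReI = this
  have R: "(CLINT x|M. complex_of_real (Re (g x)) * iexp (s * Y x)) = 0" for s
    unfolding ReI using ie[of s] null[of s] cnj[of s] by simp
  have "(CLINT x|M. complex_of_real (Im (g x)) * iexp (s * Y x)) =
      (CLINT x|M. (1/(2*\<i>)) * (g x * iexp (s * Y x) - cnj (g x) * iexp (s * Y x)))" for s
  proof (intro Bochner_Integration.integral_cong refl)
    fix x
    have "complex_of_real (Im (g x)) = (1/(2*\<i>)) * (g x - cnj (g x))"
      by (simp add: complex_eq_iff)
    then show "complex_of_real (Im (g x)) * iexp (s * Y x) =
        (1/(2*\<i>)) * (g x * iexp (s * Y x) - cnj (g x) * iexp (s * Y x))"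
      by (metis left_diff_distrib mult.assoc)
  qed
  note ImI = this
  have I: "(CLINT x|M. complex_of_real (Im (g x)) * iexp (s * Y x)) = 0" for s
    unfolding ImI using ie[of s] null[of s] cnj[of s] by simp
  have R0: "(LINT x|M. Re (g x) * indicator B (Y x)) = 0"
    using R C by (intro Fourier_null_real[where C = C]) auto
  have I0: "(LINT x|M. Im (g x) * indicator B (Y x)) = 0"
    using I C by (intro Fourier_null_real[where C = C]) auto
  have int: "integrable M (\<lambda>x. g x * indicator B (Y x))"
    by (rule integrable_const_bound[of _ C]) (use bdd order_trans[OF norm_ge_zero bdd] in \<open>auto simp: norm_mult indicator_def\<close>)
  have "Re (g x * indicator B (Y x)) = Re (g x) * indicator B (Y x)"
       "Im (g x * indicator B (Y x)) = Im (g x) * indicator B (Y x)" for x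
    by (auto simp: indicator_def)
  with R0 I0 integral_Re[OF int] integral_Im[OF int] show ?thesis
    by (simp add: complex_eq_iff)
qed

text \<open>One-dimensional uniqueness is applied to one coordinate at a time. First the exponential
  of \<open>A\<close> is replaced by an indicator, then those of the \<open>V j\<close> in turn,
  until the factorization holds for all measurable rectangles. These form an intersection-stable
  generator of the product sigma-algebra.\<close>

lemma (in prob_space) indep_PiM_charI:
  fixes A :: "'a \<Rightarrow> real" and V :: "'i \<Rightarrow> 'a \<Rightarrow> real"
  assumes fin: "finite I"
    and A[measurable]: "A \<in> borel_measurable M"
    and V[measurable]: "\<And>j. j \<in> I \<Longrightarrow> V j \<in> borel_measurable M"
    and fact: "\<And>a s. (CLINT x|M. iexp (a * A x) * iexp (\<Sum>j\<in>I. s j * V j x)) =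
       (CLINT x|M. iexp (a * A x)) * (CLINT x|M. iexp (\<Sum>j\<in>I. s j * V j x))"
  shows "distr M borel A \<Otimes>\<^sub>M distr M (PiM I (\<lambda>_. borel)) (\<lambda>x. \<lambda>j\<in>I. V j x) =
    distr M (borel \<Otimes>\<^sub>M PiM I (\<lambda>_. borel)) (\<lambda>x. (A x, \<lambda>j\<in>I. V j x))"
proof -
  \<comment> \<open>\<open>J\<close> collects the coordinates already carrying indicators; the
    others still carry exponentials with free frequencies \<open>s\<close>. Centring the indicator
    of \<open>C\<close> writes independence as the vanishing of an integral, the form that
    \<open>Fourier_null\<close> handles.\<close>
  have cyl: "(CLINT x|M. (indicator C (A x) - complex_of_real (prob {x\<in>space M. A x \<in> C})) *
        (\<Prod>j\<in>J. indicator (B j) (V j x) :: complex) * iexp (\<Sum>j\<in>I - J. s j * V j x)) = 0"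
    if "J \<subseteq> I" "C \<in> sets borel" "\<And>j. j \<in> J \<Longrightarrow> B j \<in> sets borel" for J B C s
    using finite_subset[OF that(1) fin] that
  proof (induction J arbitrary: s rule: finite_induct)
    case empty
    define K where "K = (CLINT x|M. iexp (\<Sum>j\<in>I. s j * V j x))"
    have [measurable]: "C \<in> sets borel" by fact
    have i1: "integrable M (\<lambda>x. iexp (\<Sum>j\<in>I. s j * V j x))"
      by (rule integrable_const_bound[of _ 1]) (auto simp: norm_mult)
    have i2: "integrable M (\<lambda>x. iexp (a * A x))" for a
      by (rule integrable_const_bound[of _ 1]) (auto simp: norm_mult)
    have i3: "integrable M (\<lambda>x. iexp (\<Sum>j\<in>I. s j * V j x) * iexp (a * A x))" for a
      by (rule integrable_const_bound[of _ 1]) (auto simp: norm_mult simp del: of_real_mult of_real_sum)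
    have K: "norm K \<le> 1" unfolding K_def
      using integral_norm_bound[of M "\<lambda>x. iexp (\<Sum>j\<in>I. s j * V j x)"] prob_space
      by (simp del: of_real_mult of_real_sum)
    \<comment> \<open>Here the hypothesis \<open>fact\<close> appears with the
      \<open>V\<close>-exponential centred at its mean \<open>K\<close>. \<open>Fourier_null\<close>
      then exchanges the exponential of \<open>A\<close> for the indicator of \<open>C\<close>,
      after which the centring is moved to the indicator.\<close>
    have "(CLINT x|M. (iexp (\<Sum>j\<in>I. s j * V j x) - K) * iexp (a * A x)) = 0" for a
      using fact[of a s] i2[of a] i3[of a] unfolding K_def[symmetric]
      by (simp add: left_diff_distrib right_diff_distrib mult.commute of_real_indicator del: of_real_mult of_real_sum)
    then have z: "(CLINT x|M. (iexp (\<Sum>j\<in>I. s j * V j x) - K) * indicator C (A x)) = 0"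
      using K by (intro Fourier_null[where C = 2])
        (auto intro!: order_trans[OF norm_triangle_ineq4] simp del: of_real_mult of_real_sum)
    have i4: "integrable M (\<lambda>x. iexp (\<Sum>j\<in>I. s j * V j x) * indicator C (A x))"
      by (rule integrable_const_bound[of _ 1]) (auto simp: norm_mult indicator_def simp del: of_real_mult of_real_sum)
    have i5: "integrable M (\<lambda>x. indicator C (A x) :: complex)"
      by (rule integrable_const_bound[of _ 1]) (auto simp: norm_mult indicator_def)
    have e: "(CLINT x|M. indicator C (A x)) = complex_of_real (prob {x\<in>space M. A x \<in> C})"
    proof -
      have "(CLINT x|M. indicator C (A x)) = (CLINT x|M. complex_of_real (indicator {x\<in>space M. A x \<in> C} x))"
        by (intro Bochner_Integration.integral_cong) (auto simp: indicator_def)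
      then show ?thesis by (simp add: integral_complex_of_real)
    qed
    have "(CLINT x|M. (indicator C (A x) - complex_of_real (prob {x\<in>space M. A x \<in> C})) * iexp (\<Sum>j\<in>I. s j * V j x)) =
      (CLINT x|M. iexp (\<Sum>j\<in>I. s j * V j x) * indicator C (A x)) - prob {x\<in>space M. A x \<in> C} * K"
      unfolding K_def using i1 i4 by (simp add: left_diff_distrib right_diff_distrib mult.commute of_real_indicator del: of_real_mult of_real_sum)
    also have "\<dots> = 0"
      using z i4 i5 e by (simp add: left_diff_distrib right_diff_distrib mult.commute of_real_indicator del: of_real_mult of_real_sum)
    finally show ?case by simp
  next
    case (insert l J)
    then have [measurable]: "C \<in> sets borel" "\<And>j. j \<in> J \<Longrightarrow> B j \<in> sets borel" "B l \<in> sets borel"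
      "l \<in> I" "V l \<in> borel_measurable M" "\<And>j. j \<in> J \<Longrightarrow> V j \<in> borel_measurable M"
      "\<And>j. j \<in> I - insert l J \<Longrightarrow> V j \<in> borel_measurable M"
      by auto
    \<comment> \<open>\<open>g\<close> gathers all factors that stay fixed while the exponential in
      \<open>V l\<close> becomes the indicator of \<open>B l\<close>.\<close>
    define g where "g x = (indicator C (A x) - complex_of_real (prob {x\<in>space M. A x \<in> C})) *
        (\<Prod>j\<in>J. indicator (B j) (V j x) :: complex) * iexp (\<Sum>j\<in>I - insert l J. s j * V j x)" for x
    have [measurable]: "g \<in> borel_measurable M"
      unfolding g_def by measurable
    have b: "norm (g x) \<le> 2" for x
    proof -
      have "norm (indicator C (A x) - complex_of_real (prob {x\<in>space M. A x \<in> C})) \<le> 1 + 1"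
        by (rule order_trans[OF norm_triangle_ineq4]) (intro add_mono, auto simp: indicator_def)
      moreover have "norm (\<Prod>j\<in>J. indicator (B j) (V j x) :: complex) \<le> 1"
        unfolding prod_norm[symmetric] by (rule prod_le_1) (auto simp: indicator_def)
      ultimately have "norm (indicator C (A x) - complex_of_real (prob {x\<in>space M. A x \<in> C})) *
        norm (\<Prod>j\<in>J. indicator (B j) (V j x) :: complex) \<le> 2 * 1"
        by (intro mult_mono) auto
      then show ?thesis unfolding g_def by (simp add: norm_mult del: of_real_mult of_real_sum)
    qed
    have "(CLINT x|M. g x * iexp (a * V l x)) = 0" for a
    proof -
      have D: "I - J = insert l (I - insert l J)" using insert by auto
      \<comment> \<open>The induction hypothesis holds for every frequency vector, so setting the
        frequency at \<open>l\<close> to an arbitrary \<open>a\<close> isolates the factor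
        \<open>iexp (a * V l x)\<close>.\<close>
      have "(\<Sum>j\<in>I - J. (s(l:=a)) j * V j x) = a * V l x + (\<Sum>j\<in>I - insert l J. s j * V j x)" for x
        unfolding D using fin by (subst sum.insert) (auto intro!: sum.cong)
      then have "iexp (\<Sum>j\<in>I - J. (s(l:=a)) j * V j x) =
           iexp (\<Sum>j\<in>I - insert l J. s j * V j x) * iexp (a * V l x)" for x
        by (simp add: distrib_left exp_add mult.commute del: of_real_sum of_real_mult fun_upd_apply)
      then show ?thesis using insert.IH[of "s(l:=a)"] insert.prems
        by (simp add: g_def mult.assoc of_real_indicator del: of_real_sum of_real_mult fun_upd_apply)
    qed
    then have "(CLINT x|M. g x * indicator (B l) (V l x)) = 0"
      by (intro Fourier_null[OF _ _ _ b]) auto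
    then show ?case using insert.hyps
      by (simp add: g_def mult_ac of_real_indicator del: of_real_sum of_real_mult)
  qed
  have rv: "random_variable (PiM I (\<lambda>_. borel)) (\<lambda>x. \<lambda>j\<in>I. V j x)"
    by measurable
  let ?V = "\<lambda>x. \<lambda>j\<in>I. V j x"
  let ?G = "prod_algebra I (\<lambda>_. borel :: real measure)"
  have "indep_set {A -` C \<inter> space M |C. C \<in> sets borel} {?V -` B \<inter> space M |B. B \<in> ?G}"
  proof (rule indep_setI)
    show "{A -` C \<inter> space M |C. C \<in> sets borel} \<subseteq> events" by auto
    show "{?V -` B \<inter> space M |B. B \<in> ?G} \<subseteq> events"
      by (auto intro!: measurable_sets[OF rv] simp: sets_PiM)
    fix a b assume "a \<in> {A -` C \<inter> space M |C. C \<in> sets borel}" "b \<in> {?V -` B \<inter> space M |B. B \<in> ?G}"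
    then obtain C B where C[measurable]: "C \<in> sets borel" and a: "a = A -` C \<inter> space M"
      and B: "\<And>j. j \<in> I \<Longrightarrow> B j \<in> sets borel" and b: "b = ?V -` (\<Pi>\<^sub>E j\<in>I. B j) \<inter> space M"
      unfolding prod_algebra_eq_finite[OF fin] by auto
    have bm: "b \<in> events" unfolding b using B fin by (intro measurable_sets[OF rv]) auto
    have am: "a \<in> events" unfolding a by simp
    have bi: "(\<Prod>j\<in>I. indicator (B j) (V j x)) = (indicator b x :: complex)" if x: "x \<in> space M" for x
    proof (cases "x \<in> b")
      case True then show ?thesis unfolding b by (auto simp: PiE_iff)
    next
      case False
      then obtain j where "j \<in> I" "V j x \<notin> B j" using False x unfolding b by (auto simp: PiE_iff)
      with False show ?thesis using fin by (auto intro!: prod_zero bexI[of _ j])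
    qed
    have ab: "{x \<in> space M. A x \<in> C} = a" by (auto simp: a)
    \<comment> \<open>For \<open>J = I\<close> no exponential is left: the remaining sum ranges over
      the empty set.\<close>
    have "0 = (CLINT x|M. (indicator C (A x) - complex_of_real (prob a)) * (\<Prod>j\<in>I. indicator (B j) (V j x) :: complex))"
      using cyl[of I C B "\<lambda>_. 0"] B C ab by simp
    also have "\<dots> = (CLINT x|M. complex_of_real (indicator (a \<inter> b) x - prob a * indicator b x))"
      using bi by (intro Bochner_Integration.integral_cong) (auto simp: a indicator_def)
    also have "\<dots> = complex_of_real (prob (a \<inter> b) - prob a * prob b)"
    proof -
      have "integrable M (indicator (a \<inter> b) :: _ \<Rightarrow> real)" "integrable M (indicator b :: _ \<Rightarrow> real)"
        using am bm by (auto intro!: integrable_real_indicator simp: emeasure_eq_measure)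
      then show ?thesis
        using am bm sets.sets_into_space[OF am] sets.sets_into_space[OF bm]
        unfolding integral_complex_of_real by (simp add: Int_absorb2 Int_assoc)
    qed
    finally show "prob (a \<inter> b) = prob a * prob b" by (simp flip: of_real_mult)
  qed
  then have "indep_set (sigma_sets (space M) {A -` C \<inter> space M |C. C \<in> sets borel})
     (sigma_sets (space M) {?V -` B \<inter> space M |B. B \<in> ?G})"
  proof (rule indep_set_sigma_sets)
    show "Int_stable {A -` C \<inter> space M |C. C \<in> sets borel}"
      unfolding Int_stable_def
    proof safe
      fix C C' :: "real set" assume "C \<in> sets borel" "C' \<in> sets borel"
      then show "\<exists>C''. A -` C \<inter> space M \<inter> (A -` C' \<inter> space M) = A -` C'' \<inter> space M \<and> C'' \<in> sets borel"
        by (intro exI[of _ "C \<inter> C'"]) auto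
    qed
    show "Int_stable {?V -` B \<inter> space M |B. B \<in> ?G}"
      unfolding Int_stable_def
    proof safe
      fix B B' assume "B \<in> ?G" "B' \<in> ?G"
      then have "B \<inter> B' \<in> ?G" using Int_stable_prod_algebra[of I "\<lambda>_. borel :: real measure"] by (auto simp: Int_stable_def)
      then show "\<exists>B''. ?V -` B \<inter> space M \<inter> (?V -` B' \<inter> space M) = ?V -` B'' \<inter> space M \<and> B'' \<in> ?G"
        by (intro exI[of _ "B \<inter> B'"]) auto
    qed
  qed
  then have ind: "prob (a \<inter> b) = prob a * prob b"
    if "a \<in> {A -` C \<inter> space M |C. C \<in> sets borel}"
      "b \<in> sigma_sets (space M) {?V -` B \<inter> space M |B. B \<in> ?G}" for a b
    using that unfolding indep_sets2_eq by (blast intro: sigma_sets.Basic)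
  have G: "sigma_sets (space M) {?V -` B \<inter> space M |B. B \<in> ?G} =
      {?V -` B \<inter> space M |B. B \<in> sets (PiM I (\<lambda>_. borel))}"
    unfolding sets_PiM by (rule sigma_sets_vimage_commute[symmetric]) auto
  interpret DA: prob_space "distr M borel A" by (rule prob_space_distr) fact
  interpret DV: prob_space "distr M (PiM I (\<lambda>_. borel)) ?V" by (rule prob_space_distr) fact
  show ?thesis
  proof (rule pair_measure_eqI)
    fix a b assume "a \<in> sets (distr M borel A)" "b \<in> sets (distr M (PiM I (\<lambda>_. borel)) ?V)"
    then have ab[measurable]: "a \<in> sets borel" "b \<in> sets (PiM I (\<lambda>_. borel))" by auto
    have "prob (A -` a \<inter> space M \<inter> (?V -` b \<inter> space M)) = prob (A -` a \<inter> space M) * prob (?V -` b \<inter> space M)"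
      using ab by (intro ind) (auto simp: G)
    moreover have "(\<lambda>x. (A x, ?V x)) -` (a \<times> b) \<inter> space M = A -` a \<inter> space M \<inter> (?V -` b \<inter> space M)"
      by auto
    ultimately show "emeasure (distr M borel A) a * emeasure (distr M (PiM I (\<lambda>_. borel)) ?V) b =
      emeasure (distr M (borel \<Otimes>\<^sub>M PiM I (\<lambda>_. borel)) (\<lambda>x. (A x, ?V x))) (a \<times> b)"
      using rv by (simp add: emeasure_distr emeasure_eq_measure ennreal_mult)
  qed (unfold_locales, simp cong: sets_pair_measure_cong)
qed

section \<open>Gaussian variables\<close>

lemma gaussian_rv_measurable [measurable_dest]:
  "gaussian_rv N X \<Longrightarrow> X \<in> borel_measurable N"
  by (auto simp: gaussian_rv_def distributed_def)

text \<open>In the normal case the square is expanded around the mean, which reduces it to central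
  moments.\<close>

lemma gaussian_rv_square_integrable:
  assumes "prob_space N" "gaussian_rv N X"
  shows "integrable N (\<lambda>\<omega>. (X \<omega>)\<^sup>2)"
proof -
  interpret prob_space N by fact
  from assms(2) show ?thesis unfolding gaussian_rv_def
  proof (elim disjE exE conjE)
    fix \<mu> assume [measurable]: "X \<in> borel_measurable N" and "AE \<omega> in N. X \<omega> = \<mu>"
    then show ?thesis
      by (intro integrable_const_bound[of _ "\<mu>\<^sup>2"]) (auto elim: eventually_mono)
  next
    fix \<mu> \<sigma> :: real assume "0 < \<sigma>" and D: "distributed N lborel X (normal_density \<mu> \<sigma>)"
    have "integrable lborel (\<lambda>x. normal_density \<mu> \<sigma> x * (x - \<mu>)^2 +
        (2 * \<mu>) * (normal_density \<mu> \<sigma> x * (x - \<mu>)^1) + \<mu>\<^sup>2 * normal_density \<mu> \<sigma> x)"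
      using integrable_normal_moment[OF \<open>0 < \<sigma>\<close>, of \<mu>] \<open>0 < \<sigma>\<close>
      by (intro Bochner_Integration.integrable_add integrable_mult_right integrable_normal_density)
    also have "(\<lambda>x. normal_density \<mu> \<sigma> x * (x - \<mu>)^2 +
        (2 * \<mu>) * (normal_density \<mu> \<sigma> x * (x - \<mu>)^1) + \<mu>\<^sup>2 * normal_density \<mu> \<sigma> x) =
        (\<lambda>x. normal_density \<mu> \<sigma> x * x^2)"
      by (auto simp: fun_eq_iff power2_eq_square algebra_simps)
    finally show ?thesis
      using distributed_integrable[OF D, of "\<lambda>x. x\<^sup>2"] by simp
  qed
qed

lemma square_integrable_mult:
  fixes X Y :: "'a \<Rightarrow> real"
  assumes [measurable]: "X \<in> borel_measurable M" "Y \<in> borel_measurable M"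
    and "integrable M (\<lambda>x. (X x)\<^sup>2)" "integrable M (\<lambda>x. (Y x)\<^sup>2)"
  shows "integrable M (\<lambda>x. X x * Y x)"
proof (rule Bochner_Integration.integrable_bound)
  show "integrable M (\<lambda>x. (X x)\<^sup>2 + (Y x)\<^sup>2)" using assms by simp
  have "\<bar>a * b\<bar> \<le> a\<^sup>2 + b\<^sup>2" for a b :: real
    using sum_squares_bound[of "\<bar>a\<bar>" "\<bar>b\<bar>"] mult_nonneg_nonneg[of "\<bar>a\<bar>" "\<bar>b\<bar>"]
    unfolding abs_mult power2_abs by linarith
  then show "AE x in M. norm (X x * Y x) \<le> norm ((X x)\<^sup>2 + (Y x)\<^sup>2)" by simp
qed simp

lemma gaussian_rv_cases:
  assumes "prob_space N" "gaussian_rv N X" "(LINT \<omega>|N. X \<omega>) = 0"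
  obtains "AE \<omega> in N. X \<omega> = 0" "(LINT \<omega>|N. (X \<omega>)\<^sup>2) = 0"
  | \<sigma> where "\<sigma> > 0" "distributed N lborel X (normal_density 0 \<sigma>)" "(LINT \<omega>|N. (X \<omega>)\<^sup>2) = \<sigma>\<^sup>2"
proof -
  interpret prob_space N by fact
  from assms(2) consider \<mu> where "X \<in> borel_measurable N" "AE \<omega> in N. X \<omega> = \<mu>"
    | \<mu> \<sigma> where "0 < \<sigma>" "distributed N lborel X (normal_density \<mu> \<sigma>)"
    unfolding gaussian_rv_def by blast
  then show ?thesis
  proof cases
    case 1
    note [measurable] = 1(1)
    have "(LINT \<omega>|N. X \<omega>) = (LINT \<omega>|N. \<mu>)"
      by (intro integral_cong_AE) (use 1 in auto)
    then have *: "AE \<omega> in N. X \<omega> = 0" using 1 assms(3) prob_space by simp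
    moreover have "(LINT \<omega>|N. (X \<omega>)\<^sup>2) = (LINT \<omega>|N. 0)"
      by (intro integral_cong_AE) (use * in \<open>auto elim: eventually_mono\<close>)
    ultimately show ?thesis using that by simp
  next
    case 2
    have "\<mu> = 0"
      using normal_distributed_expectation[OF 2] assms(3) by simp
    then show ?thesis
      using normal_distributed_variance[OF 2] assms(3) 2 that(2)[of \<sigma>] by simp
  qed
qed

text \<open>A single formula covers both kinds of Gaussian variable, since a centred degenerate one
  has second moment 0. The other kind is rescaled to a standard normal variable.\<close>

lemma gaussian_rv_char:
  assumes "prob_space N" "gaussian_rv N X" "(LINT \<omega>|N. X \<omega>) = 0"
  shows "(CLINT \<omega>|N. iexp (X \<omega>)) = exp (- (LINT \<omega>|N. (X \<omega>)\<^sup>2) / 2)"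
proof -
  interpret prob_space N by fact
  have [measurable]: "X \<in> borel_measurable N" using assms(2) by (rule gaussian_rv_measurable)
  from assms show ?thesis
  proof (cases rule: gaussian_rv_cases)
    case 1
    have "(CLINT \<omega>|N. iexp (X \<omega>)) = (CLINT \<omega>|N. 1)"
      by (intro integral_cong_AE) (use 1 in \<open>auto elim: eventually_mono\<close>)
    then show ?thesis using 1 prob_space by simp
  next
    case (2 \<sigma>)
    let ?Y = "\<lambda>\<omega>. X \<omega> / \<sigma>"
    have D: "distributed N lborel ?Y std_normal_density"
      using normal_standard_normal_convert[OF 2(1), of X 0] 2(2) by simp
    have "(CLINT \<omega>|N. iexp (X \<omega>)) = (CLINT x|distr N lborel ?Y. iexp (\<sigma> * x))"
      using 2(1) by (subst integral_distr) auto
    also have "\<dots> = char std_normal_distribution \<sigma>"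
      unfolding char_def distributed_distr_eq_density[OF D] by simp
    finally show ?thesis by (simp add: char_std_normal_distribution 2)
  qed
qed

text \<open>The characteristic function of a centred Gaussian depends only on the second moment. The
  cross term of \<open>a * A\<close> and any combination of the \<open>V j\<close> vanishes, so
  second moments add and characteristic functions multiply.\<close>

lemma gaussian_uncorrelated_indep:
  fixes A :: "'b \<Rightarrow> real" and V :: "'i \<Rightarrow> 'b \<Rightarrow> real"
  assumes N: "prob_space N" and fin: "finite I"
    and gauss: "\<And>a s. gaussian_rv N (\<lambda>\<omega>. a * A \<omega> + (\<Sum>j\<in>I. s j * V j \<omega>))"
    and A0: "(LINT \<omega>|N. A \<omega>) = 0" and V0: "\<And>j. j \<in> I \<Longrightarrow> (LINT \<omega>|N. V j \<omega>) = 0"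
    and uncorr: "\<And>j. j \<in> I \<Longrightarrow> (LINT \<omega>|N. A \<omega> * V j \<omega>) = 0"
  shows "distr N borel A \<Otimes>\<^sub>M distr N (PiM I (\<lambda>_. borel)) (\<lambda>x. \<lambda>j\<in>I. V j x) =
    distr N (borel \<Otimes>\<^sub>M PiM I (\<lambda>_. borel)) (\<lambda>x. (A x, \<lambda>j\<in>I. V j x))"
proof -
  interpret prob_space N by fact
  have gA: "gaussian_rv N A" using gauss[of 1 "\<lambda>_. 0"] by simp
  have gV: "gaussian_rv N (V j)" if "j \<in> I" for j
    using gauss[of 0 "\<lambda>l. if l = j then 1 else 0"] that fin
    by (simp add: if_distrib[of "\<lambda>c. c * _"] sum.delta cong: if_cong)
  have [measurable]: "A \<in> borel_measurable N" "\<And>j. j \<in> I \<Longrightarrow> V j \<in> borel_measurable N"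
    using gA gV gaussian_rv_measurable by blast+
  have L2A: "integrable N (\<lambda>\<omega>. (A \<omega>)\<^sup>2)" and L2V: "j \<in> I \<Longrightarrow> integrable N (\<lambda>\<omega>. (V j \<omega>)\<^sup>2)" for j
    using gaussian_rv_square_integrable[OF N] gA gV by auto
  have iA: "integrable N A"
    by (rule square_integrable_imp_integrable[OF _ L2A]) simp
  have iV: "integrable N (V j)" if "j \<in> I" for j
    by (rule square_integrable_imp_integrable[OF _ L2V[OF that]]) (use that in simp)
  have iAV: "integrable N (\<lambda>\<omega>. A \<omega> * V j \<omega>)" if "j \<in> I" for j
    by (rule square_integrable_mult) (use that L2A L2V in auto)
  show ?thesis
  proof (rule indep_PiM_charI[OF fin])
    fix a :: real and s :: "'i \<Rightarrow> real"
    define W where "W \<omega> = (\<Sum>j\<in>I. s j * V j \<omega>)" for \<omega>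
    have gW: "gaussian_rv N W" and gaA: "gaussian_rv N (\<lambda>\<omega>. a * A \<omega>)" and gaAW: "gaussian_rv N (\<lambda>\<omega>. a * A \<omega> + W \<omega>)"
      using gauss[of 0 s] gauss[of a "\<lambda>_. 0"] gauss[of a s] by (simp_all add: W_def[abs_def])
    have W: "integrable N W" "(LINT \<omega>|N. W \<omega>) = 0"
      unfolding W_def using iV V0 by auto
    have AW: "integrable N (\<lambda>\<omega>. A \<omega> * W \<omega>)" "(LINT \<omega>|N. A \<omega> * W \<omega>) = 0"
      unfolding W_def sum_distrib_left mult.left_commute[of "A _"] using iAV uncorr by auto
    have L2W: "integrable N (\<lambda>\<omega>. (W \<omega>)\<^sup>2)"
      using gaussian_rv_square_integrable[OF N gW] .
    have "(LINT \<omega>|N. (a * A \<omega> + W \<omega>)\<^sup>2) =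
        (LINT \<omega>|N. (a * A \<omega>)\<^sup>2 + (2 * a) * (A \<omega> * W \<omega>) + (W \<omega>)\<^sup>2)"
      by (intro Bochner_Integration.integral_cong) (auto simp: power2_eq_square algebra_simps)
    also have "\<dots> = (LINT \<omega>|N. (a * A \<omega>)\<^sup>2) + (LINT \<omega>|N. (W \<omega>)\<^sup>2)"
      using L2A L2W AW by (simp add: power_mult_distrib)
    finally have var: "(LINT \<omega>|N. (a * A \<omega> + W \<omega>)\<^sup>2) = (LINT \<omega>|N. (a * A \<omega>)\<^sup>2) + (LINT \<omega>|N. (W \<omega>)\<^sup>2)" .
    have "(CLINT \<omega>|N. iexp (a * A \<omega>) * iexp (W \<omega>)) = (CLINT \<omega>|N. iexp (a * A \<omega> + W \<omega>))"
      by (intro Bochner_Integration.integral_cong) (auto simp: exp_add distrib_left)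
    also have "\<dots> = exp (- (LINT \<omega>|N. (a * A \<omega> + W \<omega>)\<^sup>2) / 2)"
      using iA W A0 by (intro gaussian_rv_char N gaAW) simp
    also have "\<dots> = exp (- (LINT \<omega>|N. (a * A \<omega>)\<^sup>2) / 2) * exp (- (LINT \<omega>|N. (W \<omega>)\<^sup>2) / 2)"
      unfolding var by (simp add: exp_add[symmetric] add_divide_distrib)
    also have "\<dots> = (CLINT \<omega>|N. iexp (a * A \<omega>)) * (CLINT \<omega>|N. iexp (W \<omega>))"
      using gaussian_rv_char[OF N gaA] gaussian_rv_char[OF N gW] A0 W by simp
    finally show "(CLINT \<omega>|N. iexp (a * A \<omega>) * iexp (\<Sum>j\<in>I. s j * V j \<omega>)) =
        (CLINT \<omega>|N. iexp (a * A \<omega>)) * (CLINT \<omega>|N. iexp (\<Sum>j\<in>I. s j * V j \<omega>))"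
      unfolding W_def .
  qed auto
qed

section \<open>Window probabilities of centred Gaussian variables\<close>

text \<open>The integral over the window around x has derivative \<open>normal_density 0 \<sigma> (x
  + u) - normal_density 0 \<sigma> (x - u)\<close>, which is negative for x > 0 because x - u is
  then closer to 0 than x + u.\<close>

lemma normal_density_interval_decreasing:
  fixes u v w \<sigma> :: real
  assumes "\<sigma> > 0" "u > 0" "0 \<le> v" "v < w"
  shows "integral {w - u..w + u} (normal_density 0 \<sigma>) < integral {v - u..v + u} (normal_density 0 \<sigma>)"
proof -
  let ?\<phi> = "normal_density 0 \<sigma>"
  \<comment> \<open>The margin 1 puts every x - u and x + u with x in [0, w] in the interior, where
    the antiderivative \<open>g\<close> has a two-sided derivative.\<close>
  define a b where "a = - u - 1" and "b = w + u + 1"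
  have cont: "continuous_on S ?\<phi>" for S
    unfolding normal_density_def using assms by (intro continuous_intros) auto
  obtain g where g: "\<And>x. x \<in> {a..b} \<Longrightarrow> (g has_vector_derivative ?\<phi> x) (at x within {a..b})"
    using antiderivative_continuous[OF cont[of "{a..b}"]] by blast
  have int: "integral {x - u..x + u} ?\<phi> = g (x + u) - g (x - u)" if "0 \<le> x" "x \<le> w" for x
  proof (intro integral_unique fundamental_theorem_of_calculus)
    fix y assume "y \<in> {x - u..x + u}"
    then show "(g has_vector_derivative ?\<phi> y) (at y within {x - u..x + u})"
      using that by (intro has_vector_derivative_within_subset[OF g]) (auto simp: a_def b_def)
  qed (use assms in auto)
  have der: "(g has_real_derivative ?\<phi> x) (at x)" if "a < x" "x < b" for x
  proof -
    have "(g has_real_derivative ?\<phi> x) (at x within {a..b})"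
      using g[of x] that by (simp add: has_real_derivative_iff_has_vector_derivative)
    then show ?thesis using that at_within_Icc_at[of a x b] by simp
  qed
  have der2: "((\<lambda>x. g (x + u) - g (x - u)) has_real_derivative ?\<phi> (x + u) - ?\<phi> (x - u)) (at x)"
    if "0 \<le> x" "x \<le> w" for x
    using that assms
    by (auto intro!: derivative_eq_intros DERIV_chain2[OF der] simp: a_def b_def)
  have "g (w + u) - g (w - u) < g (v + u) - g (v - u)"
  \<comment> \<open>The derivative is 0 at x = 0, so for v = 0 it is negative only on the open
    interval.\<close>
  proof (rule DERIV_neg_imp_decreasing_open[OF assms(4)])
    fix x assume x: "v < x" "x < w"
    have "(x - u)\<^sup>2 < (x + u)\<^sup>2"
      using mult_pos_pos[of x u] x assms by (simp add: power2_eq_square algebra_simps)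
    then have "?\<phi> (x + u) < ?\<phi> (x - u)"
      using assms unfolding normal_density_def by (auto simp: field_simps)
    then have "?\<phi> (x + u) - ?\<phi> (x - u) < 0" by simp
    moreover have "0 \<le> x" "x \<le> w" using x assms by simp_all
    ultimately show "\<exists>y. ((\<lambda>x. g (x + u) - g (x - u)) has_real_derivative y) (at x) \<and> y < 0"
      using der2 by blast
  next
    show "continuous_on {v..w} (\<lambda>x. g (x + u) - g (x - u))"
    proof (intro continuous_at_imp_continuous_on ballI)
      fix x assume "x \<in> {v..w}"
      then have "0 \<le> x" "x \<le> w" using assms by simp_all
      then show "isCont (\<lambda>x. g (x + u) - g (x - u)) x"
        by (rule DERIV_isCont[OF der2])
    qed
  qed
  then show ?thesis using int[of v] int[of w] assms by simp
qed

text \<open>For a nondegenerate \<open>A\<close> the window probability is a strictly decreasing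
  function of the size of the shift. For \<open>A\<close> = 0 it drops from 1 to 0 as the shift
  passes \<open>u\<close>. The strict part therefore asks for a shift larger than \<open>u\<close>,
  which works in both cases.\<close>

lemma gaussian_rv_window:
  fixes u v w :: real
  assumes N: "prob_space N" and A: "gaussian_rv N A" "(LINT \<omega>|N. A \<omega>) = 0" and u: "u > 0"
  shows gaussian_rv_window_mono: "\<bar>v\<bar> \<le> \<bar>w\<bar> \<Longrightarrow>
      measure N {\<omega> \<in> space N. \<bar>A \<omega> + w\<bar> \<le> u} \<le> measure N {\<omega> \<in> space N. \<bar>A \<omega> + v\<bar> \<le> u}"
    and gaussian_rv_window_less: "u < \<bar>w\<bar> \<Longrightarrow>
      measure N {\<omega> \<in> space N. \<bar>A \<omega> + w\<bar> \<le> u} < measure N {\<omega> \<in> space N. \<bar>A \<omega>\<bar> \<le> u}"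
proof -
  interpret prob_space N by fact
  have [measurable]: "A \<in> borel_measurable N" using A(1) by (rule gaussian_rv_measurable)
  let ?g = "\<lambda>v. measure N {\<omega> \<in> space N. \<bar>A \<omega> + v\<bar> \<le> u}"
  have "(\<bar>v\<bar> \<le> \<bar>w\<bar> \<longrightarrow> ?g w \<le> ?g v) \<and> (u < \<bar>w\<bar> \<longrightarrow> ?g w < ?g 0)"
    using N A
  proof (cases rule: gaussian_rv_cases)
    case 1
    have "?g x = (if \<bar>x\<bar> \<le> u then 1 else 0)" for x
    proof (cases "\<bar>x\<bar> \<le> u")
      case True
      then have "?g x = 1" using 1 by (subst prob_Collect_eq_1) (auto elim: eventually_mono)
      with True show ?thesis by simp
    next
      case False
      then have "?g x = 0" using 1 by (subst prob_Collect_eq_0) (auto elim: eventually_mono)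
      with False show ?thesis by simp
    qed
    from this[of v] this[of w] this[of 0] show ?thesis using u by auto
  next
    case (2 \<sigma>)
    let ?\<phi> = "normal_density 0 \<sigma>"
    have G0: "?g x = integral {- x - u..- x + u} ?\<phi>" for x
    proof -
      have [measurable]: "{- x - u..- x + u} \<in> sets lborel" by simp
      have "{\<omega> \<in> space N. \<bar>A \<omega> + x\<bar> \<le> u} = A -` {- x - u..- x + u} \<inter> space N"
        by auto
      then have "?g x = measure (distr N lborel A) {- x - u..- x + u}"
        by (simp add: measure_distr)
      also have "\<dots> = (LINT y|density lborel ?\<phi>. indicator {- x - u..- x + u} y)"
        unfolding distributed_distr_eq_density[OF 2(2)] by simp
      also have "\<dots> = (LINT y:{- x - u..- x + u}|lborel. ?\<phi> y)"
        by (subst integral_density) (auto simp: set_lebesgue_integral_def mult.commute)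
      also have "\<dots> = integral {- x - u..- x + u} ?\<phi>"
        using integrable_mult_indicator[OF _ integrable_normal_density[OF 2(1)], of "{- x - u..- x + u}" 0]
        by (intro set_borel_integral_eq_integral) (simp add: set_integrable_def)
      finally show ?thesis .
    qed
    have even: "?\<phi> (- x) = ?\<phi> x" for x by (simp add: normal_density_def)
    define h where "h y = integral {y - u..y + u} ?\<phi>" for y
    have G: "?g x = h \<bar>x\<bar>" for x
    proof (cases "x \<le> 0")
      case True
      then show ?thesis by (simp add: G0 h_def)
    next
      case False
      have "integral {- (x + u)..- (x - u)} (\<lambda>y. ?\<phi> (- y)) = integral {x - u..x + u} ?\<phi>"
        by (rule Henstock_Kurzweil_Integration.integral_reflect_real)
      moreover have "- (x + u) = - x - u" "- (x - u) = - x + u" by simp_all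
      ultimately show ?thesis using False unfolding G0 h_def even by simp
    qed
    have h: "h y < h x" if "0 \<le> x" "x < y" for x y
      unfolding h_def using normal_density_interval_decreasing[OF 2(1) u that] .
    have "\<bar>v\<bar> \<le> \<bar>w\<bar> \<longrightarrow> h \<bar>w\<bar> \<le> h \<bar>v\<bar>"
      using h[of "\<bar>v\<bar>" "\<bar>w\<bar>"] by fastforce
    moreover have "u < \<bar>w\<bar> \<longrightarrow> h \<bar>w\<bar> < h \<bar>0\<bar>"
      using h[of 0 "\<bar>w\<bar>"] u by simp
    ultimately show ?thesis using G[of v] G[of w] G[of 0] by metis
  qed
  then show "\<bar>v\<bar> \<le> \<bar>w\<bar> \<Longrightarrow> ?g w \<le> ?g v"
    "u < \<bar>w\<bar> \<Longrightarrow> ?g w < measure N {\<omega> \<in> space N. \<bar>A \<omega>\<bar> \<le> u}"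
    by auto
qed

text \<open>A positive second moment excludes the degenerate case, and a normal density is positive
  on the whole ray above \<open>c\<close>.\<close>

lemma gaussian_rv_tail_pos:
  assumes N: "prob_space N" and Y: "gaussian_rv N Y" "(LINT \<omega>|N. Y \<omega>) = 0" "0 < (LINT \<omega>|N. (Y \<omega>)\<^sup>2)"
  shows "0 < measure N {\<omega> \<in> space N. c < Y \<omega>}"
  using N Y(1,2)
proof (cases rule: gaussian_rv_cases)
  case 1
  with Y(3) show ?thesis by simp
next
  case (2 \<sigma>)
  interpret prob_space N by fact
  have [measurable]: "Y \<in> borel_measurable N" using Y(1) by (rule gaussian_rv_measurable)
  have "{\<omega> \<in> space N. c < Y \<omega>} = Y -` {c<..} \<inter> space N" by auto
  then have *: "emeasure N {\<omega> \<in> space N. c < Y \<omega>} = (\<integral>\<^sup>+x. ennreal (normal_density 0 \<sigma> x) * indicator {c<..} x \<partial>lborel)"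
    using distributed_emeasure[OF 2(2), of "{c<..}"] by simp
  have "\<not> (AE x in lborel. x \<notin> {c<..})"
  proof
    assume "AE x in lborel. x \<notin> {c<..}"
    then have "AE x in lborel. x \<notin> {c<..<c + 1}" by (auto elim: eventually_mono)
    then have "emeasure lborel {x \<in> space lborel. \<not> x \<notin> {c<..<c + 1}} = 0"
      by (subst (asm) AE_iff_measurable[OF _ refl]) auto
    then show False by (simp add: greaterThanLessThan_def[symmetric] del: greaterThanLessThan_iff)
  qed
  moreover have "(AE x in lborel. ennreal (normal_density 0 \<sigma> x) * indicator {c<..} x = 0) \<longleftrightarrow>
      (AE x in lborel. x \<notin> {c<..})"
  proof -
    have "ennreal (normal_density 0 \<sigma> x) \<noteq> 0" for x
      using normal_density_pos[OF 2(1), of 0 x] by (simp add: ennreal_eq_0_iff not_le)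
    then show ?thesis by (intro AE_cong) (auto simp: indicator_def)
  qed
  ultimately have "emeasure N {\<omega> \<in> space N. c < Y \<omega>} \<noteq> 0"
    unfolding * by (subst nn_integral_0_iff_AE) auto
  then show ?thesis by (simp add: emeasure_eq_measure zero_less_measure_iff)
qed

section \<open>Comparison of translation equivariant estimators\<close>

text \<open>This is Fubini for the product law: \<open>g\<close> is the conditional probability of
  the window event given the vector \<open>V\<close>, obtained by freezing \<open>V\<close> and
  drawing \<open>A\<close> afresh.\<close>

lemma window_disintegration:
  fixes A :: "'b \<Rightarrow> real" and V :: "'i \<Rightarrow> 'b \<Rightarrow> real" and f :: "('i \<Rightarrow> real) \<Rightarrow> real" and u :: real
  assumes N: "prob_space N"
    and A[measurable]: "A \<in> borel_measurable N" and V[measurable]: "\<And>j. j \<in> I \<Longrightarrow> V j \<in> borel_measurable N"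
    and f[measurable]: "f \<in> borel_measurable (PiM I (\<lambda>_. borel))"
    and indep: "distr N borel A \<Otimes>\<^sub>M distr N (PiM I (\<lambda>_. borel)) (\<lambda>x. \<lambda>j\<in>I. V j x) =
      distr N (borel \<Otimes>\<^sub>M PiM I (\<lambda>_. borel)) (\<lambda>x. (A x, \<lambda>j\<in>I. V j x))"
  defines "g \<equiv> \<lambda>\<omega>. measure N {\<omega>' \<in> space N. \<bar>A \<omega>' + f (\<lambda>j\<in>I. V j \<omega>)\<bar> \<le> u}"
  shows "integrable N g" and "measure N {\<omega> \<in> space N. \<bar>A \<omega> + f (\<lambda>j\<in>I. V j \<omega>)\<bar> \<le> u} = (LINT \<omega>|N. g \<omega>)"
proof -
  interpret prob_space N by fact
  let ?V = "\<lambda>x. \<lambda>j\<in>I. V j x" and ?P = "PiM I (\<lambda>_. borel :: real measure)"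
  have rv[measurable]: "?V \<in> measurable N ?P" by measurable
  interpret DA: prob_space "distr N borel A" by (rule prob_space_distr) fact
  interpret DV: prob_space "distr N ?P ?V" by (rule prob_space_distr) fact
  interpret P: pair_prob_space "distr N borel A" "distr N ?P ?V" ..
  define Q where "Q = {z \<in> space (borel \<Otimes>\<^sub>M ?P). \<bar>fst z + f (snd z)\<bar> \<le> u}"
  have Q[measurable]: "Q \<in> sets (borel \<Otimes>\<^sub>M ?P)" unfolding Q_def by measurable
  then have Q': "Q \<in> sets (distr N borel A \<Otimes>\<^sub>M distr N ?P ?V)"
    by (simp cong: sets_pair_measure_cong)
  define G where "G y = emeasure (distr N borel A) ((\<lambda>x. (x, y)) -` Q)" for y
  have "G \<in> borel_measurable (distr N ?P ?V)"
    unfolding G_def by (rule P.measurable_emeasure_Pair2[OF Q'])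
  then have G[measurable]: "G \<in> borel_measurable ?P" by simp
  have Gg: "G (?V \<omega>) = ennreal (g \<omega>)" if "\<omega> \<in> space N" for \<omega>
  proof -
    have "?V \<omega> \<in> space ?P" using measurable_space[OF rv that] .
    then have "(\<lambda>x. (x, ?V \<omega>)) -` Q = {x. \<bar>x + f (?V \<omega>)\<bar> \<le> u}"
      by (auto simp: Q_def space_pair_measure)
    moreover have "A -` {x. \<bar>x + f (?V \<omega>)\<bar> \<le> u} \<inter> space N = {\<omega>' \<in> space N. \<bar>A \<omega>' + f (?V \<omega>)\<bar> \<le> u}"
      by auto
    ultimately show ?thesis
      unfolding G_def g_def by (simp add: emeasure_distr emeasure_eq_measure)
  qed
  \<comment> \<open>Measurability of \<open>g\<close> comes from this function, which agrees with it
    on \<open>space N\<close>.\<close>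
  have "(\<lambda>\<omega>. enn2real (G (?V \<omega>))) \<in> borel_measurable N" by measurable
  then have "g \<in> borel_measurable N"
    by (rule measurable_cong[THEN iffD1, rotated]) (simp add: Gg g_def)
  then show int: "integrable N g"
    by (intro integrable_const_bound[of _ 1]) (auto simp: g_def)
  have "ennreal (measure N {\<omega> \<in> space N. \<bar>A \<omega> + f (?V \<omega>)\<bar> \<le> u}) =
      emeasure (distr N (borel \<Otimes>\<^sub>M ?P) (\<lambda>x. (A x, ?V x))) Q"
    using measurable_space[OF rv] unfolding emeasure_eq_measure[symmetric]
    by (subst emeasure_distr) (auto intro!: arg_cong[where f = "emeasure N"] simp: Q_def space_pair_measure)
  also have "\<dots> = (\<integral>\<^sup>+y. G y \<partial>distr N ?P ?V)"
    unfolding indep[symmetric] G_def by (rule P.emeasure_pair_measure_alt2[OF Q'])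
  also have "\<dots> = (\<integral>\<^sup>+\<omega>. ennreal (g \<omega>) \<partial>N)"
    by (subst nn_integral_distr) (auto intro!: nn_integral_cong simp: Gg)
  also have "\<dots> = ennreal (LINT \<omega>|N. g \<omega>)"
    using int by (rule nn_integral_eq_integral) (simp add: g_def)
  finally show "measure N {\<omega> \<in> space N. \<bar>A \<omega> + f (?V \<omega>)\<bar> \<le> u} = (LINT \<omega>|N. g \<omega>)"
    by (subst (asm) ennreal_inj) (auto simp: g_def intro!: Bochner_Integration.integral_nonneg)
qed

text \<open>Equal row sums of the covariance matrix make the mean \<open>A\<close> uncorrelated
  with, hence independent of, the deviations \<open>V j\<close>. By equivariance each estimator is
  \<open>A\<close> plus its value at the deviations. Given the deviations, \<open>closer\<close>
  says that \<open>f'\<close> shifts \<open>A\<close> by no more than \<open>f\<close> does, so its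
  window probability is at least as large.\<close>

lemma gaussian_equivariant_comparison:
  fixes X :: "'i \<Rightarrow> 'b \<Rightarrow> real" and f f' :: "('i \<Rightarrow> real) \<Rightarrow> real" and I :: "'i set"
  defines "m \<equiv> \<lambda>x. (\<Sum>l\<in>I. x l) / card I"
  assumes N: "prob_space N" and I: "finite I" "I \<noteq> {}"
    and gauss: "gaussian_family N I X"
    and mean: "\<And>j. j \<in> I \<Longrightarrow> (LINT \<omega>|N. X j \<omega>) = 0"
    and row: "\<And>j. j \<in> I \<Longrightarrow> (\<Sum>l\<in>I. LINT \<omega>|N. X l \<omega> * X j \<omega>) = \<kappa>"
    and meas: "f \<in> borel_measurable (PiM I (\<lambda>_. borel))" "f' \<in> borel_measurable (PiM I (\<lambda>_. borel))"
    and shift: "\<And>x c. f (\<lambda>j. x j + c) = f x + c" "\<And>x c. f' (\<lambda>j. x j + c) = f' x + c"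
    and loc: "\<And>x. f (restrict x I) = f x" "\<And>x. f' (restrict x I) = f' x"
    and closer: "\<And>x. \<bar>f' x - m x\<bar> \<le> \<bar>f x - m x\<bar>"
    and u: "u > 0"
  shows gaussian_equivariant_comparison_le:
      "measure N {\<omega> \<in> space N. \<bar>f (\<lambda>j. X j \<omega>)\<bar> \<le> u} \<le> measure N {\<omega> \<in> space N. \<bar>f' (\<lambda>j. X j \<omega>)\<bar> \<le> u}"
    and gaussian_equivariant_comparison_less:
      "0 < measure N {\<omega> \<in> space N. P \<omega>} \<Longrightarrow>
       (\<And>\<omega>. \<omega> \<in> space N \<Longrightarrow> P \<omega> \<Longrightarrow> f' (\<lambda>j. X j \<omega>) = m (\<lambda>j. X j \<omega>) \<and> u < \<bar>f (\<lambda>j. X j \<omega>) - m (\<lambda>j. X j \<omega>)\<bar>) \<Longrightarrow>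
      measure N {\<omega> \<in> space N. \<bar>f (\<lambda>j. X j \<omega>)\<bar> \<le> u} < measure N {\<omega> \<in> space N. \<bar>f' (\<lambda>j. X j \<omega>)\<bar> \<le> u}"
proof -
  interpret prob_space N by fact
  define n where "n = real (card I)"
  have n: "n > 0" using I by (simp add: n_def card_gt_0_iff)
  have lin: "gaussian_rv N (\<lambda>\<omega>. \<Sum>j\<in>I. a j * X j \<omega>)" for a
    using gauss I(1) unfolding gaussian_family_def by simp
  have gX: "gaussian_rv N (X j)" if "j \<in> I" for j
    using lin[of "\<lambda>l. if l = j then 1 else 0"] that I(1)
    by (simp add: if_distrib[of "\<lambda>c. c * _"] cong: if_cong)
  note [measurable] = gaussian_rv_measurable[OF gX]
  have L2: "integrable N (\<lambda>\<omega>. (X j \<omega>)\<^sup>2)" if "j \<in> I" for j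
    using gaussian_rv_square_integrable[OF N gX[OF that]] .
  have iX: "integrable N (X j)" if "j \<in> I" for j
    by (rule square_integrable_imp_integrable[OF _ L2[OF that]]) (use that in simp)
  have iXX: "integrable N (\<lambda>\<omega>. X l \<omega> * X j \<omega>)" if "l \<in> I" "j \<in> I" for l j
    by (rule square_integrable_mult) (use that L2 in auto)
  define A where "A \<omega> = m (\<lambda>j. X j \<omega>)" for \<omega>
  define V where "V j \<omega> = X j \<omega> - A \<omega>" for j \<omega>
  have A_eq: "A \<omega> = (\<Sum>j\<in>I. (1/n) * X j \<omega>)" for \<omega>
    by (simp add: A_def m_def n_def sum_divide_distrib)
  have gA: "gaussian_rv N A" using lin[of "\<lambda>_. 1/n"] by (simp add: A_eq[abs_def])
  note [measurable] = gaussian_rv_measurable[OF gA]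
  have A0: "(LINT \<omega>|N. A \<omega>) = 0"
    unfolding A_eq using iX mean by simp
  have iA: "integrable N A" unfolding A_eq[abs_def] using iX by simp
  have AX: "integrable N (\<lambda>\<omega>. A \<omega> * X j \<omega>)" "(LINT \<omega>|N. A \<omega> * X j \<omega>) = \<kappa> / n" if "j \<in> I" for j
    using row[OF that] iXX[OF _ that]
    by (simp_all add: A_eq sum_distrib_right mult.assoc sum_divide_distrib[symmetric])
  \<comment> \<open>The value equals that of \<open>A\<close> against any \<open>X j\<close>, so the
    product of \<open>A\<close> and \<open>V j\<close> has mean 0.\<close>
  have AA: "integrable N (\<lambda>\<omega>. A \<omega> * A \<omega>)" "(LINT \<omega>|N. A \<omega> * A \<omega>) = \<kappa> / n"
  proof -
    have *: "A \<omega> * A \<omega> = (\<Sum>j\<in>I. (1/n) * (A \<omega> * X j \<omega>))" for \<omega>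
      by (subst (2) A_eq) (simp add: sum_distrib_left mult.left_commute)
    show "integrable N (\<lambda>\<omega>. A \<omega> * A \<omega>)" "(LINT \<omega>|N. A \<omega> * A \<omega>) = \<kappa> / n"
      unfolding * using AX n I by (simp_all add: n_def)
  qed
  have [measurable]: "V j \<in> borel_measurable N" if "j \<in> I" for j
    unfolding V_def[abs_def] using that by measurable
  have indep: "distr N borel A \<Otimes>\<^sub>M distr N (PiM I (\<lambda>_. borel)) (\<lambda>x. \<lambda>j\<in>I. V j x) =
      distr N (borel \<Otimes>\<^sub>M PiM I (\<lambda>_. borel)) (\<lambda>x. (A x, \<lambda>j\<in>I. V j x))"
  proof (rule gaussian_uncorrelated_indep[OF N I(1) _ A0])
    fix a :: real and s :: "'i \<Rightarrow> real"
    \<comment> \<open>The net coefficient of \<open>A\<close> is \<open>a\<close> minus the sum of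
      the \<open>s l\<close>, and it is spread evenly over the \<open>X j\<close>. Joint Gaussianity
      is thus inherited from \<open>X\<close>.\<close>
    have "a * A \<omega> + (\<Sum>j\<in>I. s j * V j \<omega>) = (\<Sum>j\<in>I. (s j + (a - (\<Sum>l\<in>I. s l)) / n) * X j \<omega>)" for \<omega>
    proof -
      have "a * A \<omega> + (\<Sum>j\<in>I. s j * V j \<omega>) = (a - (\<Sum>l\<in>I. s l)) * A \<omega> + (\<Sum>j\<in>I. s j * X j \<omega>)"
        by (simp add: V_def right_diff_distrib sum_subtractf sum_distrib_right left_diff_distrib)
      then show ?thesis
        by (simp add: A_eq sum_distrib_left sum.distrib[symmetric] distrib_right add.commute)
    qed
    then show "gaussian_rv N (\<lambda>\<omega>. a * A \<omega> + (\<Sum>j\<in>I. s j * V j \<omega>))" using lin by simp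
  next
    fix j assume j: "j \<in> I"
    show "(LINT \<omega>|N. V j \<omega>) = 0" unfolding V_def using iX[OF j] iA A0 mean[OF j] by simp
    show "(LINT \<omega>|N. A \<omega> * V j \<omega>) = 0"
      unfolding V_def right_diff_distrib using AX[OF j] AA by simp
  qed
  have split: "h (\<lambda>j. X j \<omega>) = A \<omega> + h (\<lambda>j\<in>I. V j \<omega>)"
    if "\<And>x c. h (\<lambda>j. x j + c) = h x + c" "\<And>x. h (restrict x I) = h x" for h :: "('i \<Rightarrow> real) \<Rightarrow> real" and \<omega>
    using that(1)[of "\<lambda>j. V j \<omega>" "A \<omega>"] that(2) by (simp add: V_def)
  let ?V = "\<lambda>\<omega>. \<lambda>j\<in>I. V j \<omega>"
  let ?g = "\<lambda>h \<omega>. measure N {\<omega>' \<in> space N. \<bar>A \<omega>' + h (?V \<omega>)\<bar> \<le> u}"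
  have dis: "integrable N (?g h)" "measure N {\<omega> \<in> space N. \<bar>A \<omega> + h (?V \<omega>)\<bar> \<le> u} = (LINT \<omega>|N. ?g h \<omega>)"
    if "h \<in> borel_measurable (PiM I (\<lambda>_. borel))" for h
    by (rule window_disintegration[OF N _ _ that indep]; measurable)+
  have le: "?g f \<omega> \<le> ?g f' \<omega>" for \<omega>
  proof (rule gaussian_rv_window_mono[OF N gA A0 u])
    show "\<bar>f' (?V \<omega>)\<bar> \<le> \<bar>f (?V \<omega>)\<bar>"
      using closer[of "\<lambda>j. X j \<omega>"]
      unfolding split[OF shift(1) loc(1)] split[OF shift(2) loc(2)] A_def[symmetric]
      by (simp only: add_diff_cancel_left')
  qed
  show "measure N {\<omega> \<in> space N. \<bar>f (\<lambda>j. X j \<omega>)\<bar> \<le> u} \<le> measure N {\<omega> \<in> space N. \<bar>f' (\<lambda>j. X j \<omega>)\<bar> \<le> u}"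
    unfolding split[OF shift(1) loc(1)] split[OF shift(2) loc(2)] dis(2)[OF meas(1)] dis(2)[OF meas(2)]
    by (intro integral_mono dis meas le)
  show "measure N {\<omega> \<in> space N. \<bar>f (\<lambda>j. X j \<omega>)\<bar> \<le> u} < measure N {\<omega> \<in> space N. \<bar>f' (\<lambda>j. X j \<omega>)\<bar> \<le> u}"
    if pos: "0 < measure N {\<omega> \<in> space N. P \<omega>}"
      and P: "\<And>\<omega>. \<omega> \<in> space N \<Longrightarrow> P \<omega> \<Longrightarrow> f' (\<lambda>j. X j \<omega>) = m (\<lambda>j. X j \<omega>) \<and> u < \<bar>f (\<lambda>j. X j \<omega>) - m (\<lambda>j. X j \<omega>)\<bar>"
  proof -
    have "?g f \<omega> \<noteq> ?g f' \<omega>" if "\<omega> \<in> space N" "P \<omega>" for \<omega>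
    proof -
      have "f' (?V \<omega>) = 0" "u < \<bar>f (?V \<omega>)\<bar>"
        using P[OF that]
        unfolding split[OF shift(1) loc(1)] split[OF shift(2) loc(2)] A_def[symmetric]
        by (simp_all only: add_diff_cancel_left' add_cancel_left_right)
      then show ?thesis using gaussian_rv_window_less[OF N gA A0 u] by fastforce
    qed
    moreover have "emeasure N {\<omega> \<in> space N. P \<omega>} \<noteq> 0" "{\<omega> \<in> space N. P \<omega>} \<in> events"
      using pos measure_notin_sets[of "{\<omega> \<in> space N. P \<omega>}" N] by (auto simp: emeasure_eq_measure)
    ultimately show ?thesis
      unfolding split[OF shift(1) loc(1)] split[OF shift(2) loc(2)] dis(2)[OF meas(1)] dis(2)[OF meas(2)]
      using le by (intro integral_less_AE[where A = "{\<omega> \<in> space N. P \<omega>}"] dis meas) auto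
  qed
qed

section \<open>The max-min estimator on growing intervals\<close>

definition avg :: "(nat \<Rightarrow> real) \<Rightarrow> nat \<Rightarrow> nat \<Rightarrow> real" where
  "avg x r s = (\<Sum>j=r..s. x j) / (real s - real r + 1)"

text \<open>This is the max-min formula for the value at \<open>i\<close> of the equally weighted
  isotonic regression over [a, b]. Unlike in \<open>Z_star\<close>, the endpoints are free, so that
  the block can grow.\<close>

definition maxmin :: "nat \<Rightarrow> nat \<Rightarrow> nat \<Rightarrow> (nat \<Rightarrow> real) \<Rightarrow> real" where
  "maxmin a b i x = (MAX r\<in>{a..i}. MIN s\<in>{i..b}. avg x r s)"

lemma avg_eq_mean: "r \<le> s \<Longrightarrow> avg x r s = (\<Sum>l\<in>{r..s}. x l) / card {r..s}"
  by (simp add: avg_def of_nat_diff)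

lemma avg_shift: "r \<le> s \<Longrightarrow> avg (\<lambda>j. x j + c) r s = avg x r s + c"
  by (simp add: avg_def sum.distrib field_simps of_nat_diff)

text \<open>Sums of excesses over \<open>v\<close> add up over adjacent blocks, which averages do
  not.\<close>

lemma less_avg_iff:
  assumes "r \<le> s"
  shows "v < avg x r s \<longleftrightarrow> 0 < (\<Sum>j=r..s. x j - v)"
  using assms by (simp add: avg_def sum_subtractf field_simps of_nat_diff)

lemma less_maxmin_iff:
  assumes "a \<le> i" "i \<le> b"
  shows "v < maxmin a b i x \<longleftrightarrow> (\<exists>r\<in>{a..i}. \<forall>s\<in>{i..b}. v < avg x r s)"
  using assms by (simp add: maxmin_def Max_gr_iff Min_gr_iff)

lemma maxmin_shift:
  assumes "a \<le> i" "i \<le> b"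
  shows "maxmin a b i (\<lambda>j. x j + c) = maxmin a b i x + c"
proof -
  \<comment> \<open>Two reals with the same strict lower bounds are equal.\<close>
  have "v < maxmin a b i (\<lambda>j. x j + c) \<longleftrightarrow> v < maxmin a b i x + c" for v
    using assms less_maxmin_iff[OF assms, of "v - c" x]
    by (auto simp: less_maxmin_iff avg_shift diff_less_eq)
  then show ?thesis by (meson less_irrefl linorder_neqE)
qed

lemma maxmin_restrict:
  assumes "{a..b} \<subseteq> I"
  shows "maxmin a b i (restrict x I) = maxmin a b i x"
  unfolding maxmin_def avg_def
  by (intro arg_cong[where f = Max] image_cong arg_cong[where f = Min] refl arg_cong2[where f = "(/)"] sum.cong)
     (use assms in \<open>auto simp: subset_eq\<close>)

lemma maxmin_measurable:
  assumes "{a..b} \<subseteq> I"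
  shows "maxmin a b i \<in> borel_measurable (PiM I (\<lambda>_. borel))"
proof -
  have "(\<lambda>x. \<Sum>j=r..s. x j) \<in> borel_measurable (PiM I (\<lambda>_. borel :: real measure))"
    if "r \<in> {a..i}" "s \<in> {i..b}" for r s
    using that assms by (intro borel_measurable_sum measurable_component_singleton) auto
  then show ?thesis
    unfolding maxmin_def[abs_def] avg_def
    by (intro borel_measurable_Max borel_measurable_Min borel_measurable_divide) auto
qed

lemma sum_Icc_split:
  fixes x :: "nat \<Rightarrow> real"
  assumes "a \<le> r" "r \<le> s"
  shows "(\<Sum>j=a..s. x j) = (\<Sum>j=a..<r. x j) + (\<Sum>j=r..s. x j)"
  using sum.atLeastLessThan_concat[of a r "Suc s" x] assms
  by (simp add: atLeastLessThanSuc_atLeastAtMost)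

text \<open>If adding \<open>b + 1\<close> moved the estimate down past the mean over $[a, b+1]$ to \<open>z\<close>, then the
  stretch from \<open>a\<close> to the old maximiser \<open>r\<close> would have mean above \<open>z\<close>, so that blocks starting at \<open>a\<close>
  would all have mean above \<open>z\<close>.\<close>

lemma maxmin_extend_right:
  assumes i: "a \<le> i" "i \<le> b"
  defines "m \<equiv> \<lambda>x. avg x a (Suc b)"
  shows "\<bar>maxmin a (Suc b) i x - m x\<bar> \<le> \<bar>maxmin a b i x - m x\<bar>"
proof -
  let ?z = "maxmin a (Suc b) i x" and ?y = "maxmin a b i x"
  have i': "a \<le> i" "i \<le> Suc b" using i by auto
  have le: "?z \<le> ?y"
  proof (rule ccontr)
    assume "\<not> ?z \<le> ?y"
    then obtain r where "r \<in> {a..i}" "\<forall>s\<in>{i..Suc b}. ?y < avg x r s"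
      using less_maxmin_iff[OF i', of ?y x] by auto
    then have "?y < ?y" by (subst less_maxmin_iff[OF i]) (auto intro!: bexI[of _ r])
    then show False by simp
  qed
  \<comment> \<open>This suffices: either the estimate does not change, or it moves down from
    \<open>?y\<close> without passing the mean.\<close>
  have "m x \<le> ?z" if less: "?z < ?y"
  proof (rule ccontr)
    assume "\<not> m x \<le> ?z"
    then have tot: "0 < (\<Sum>j=a..Suc b. x j - ?z)"
      using less_avg_iff[of a "Suc b" ?z x] i by (simp add: m_def)
    obtain r where r: "r \<in> {a..i}" "\<forall>s\<in>{i..b}. ?z < avg x r s"
      using less less_maxmin_iff[OF i, of ?z x] by auto
    have "\<not> (\<forall>s\<in>{i..Suc b}. ?z < avg x r s)"
      using less_maxmin_iff[OF i', of ?z x] r(1) by blast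
    then have "\<not> ?z < avg x r (Suc b)"
      using r(2) by (auto simp: le_Suc_eq)
    then have "(\<Sum>j=r..Suc b. x j - ?z) \<le> 0"
      using less_avg_iff[of r "Suc b" ?z x] r i by simp
    then have pre: "0 < (\<Sum>j=a..<r. x j - ?z)"
      using tot sum_Icc_split[of a r "Suc b" "\<lambda>j. x j - ?z"] r i by simp
    have "?z < avg x a s" if "s \<in> {i..Suc b}" for s
    proof (cases "s = Suc b")
      case True
      then show ?thesis using tot i by (simp add: less_avg_iff)
    next
      case False
      then have "0 < (\<Sum>j=r..s. x j - ?z)"
        using that r less_avg_iff[of r s ?z x] by auto
      then show ?thesis
        using pre sum_Icc_split[of a r s "\<lambda>j. x j - ?z"] r that i by (simp add: less_avg_iff)
    qed
    then have "?z < ?z"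
      using i by (subst less_maxmin_iff[OF i']) (auto intro!: bexI[of _ a])
    then show False by simp
  qed
  with le show ?thesis by (cases "?z = ?y") auto
qed

text \<open>The new index only adds the candidate \<open>r = a\<close> to the maximum, so the
  estimate cannot fall. If it rises, the maximum is attained at that candidate, whose minimum
  includes the average over all of [a, b]; the estimate thus moves up without passing the
  mean.\<close>

lemma maxmin_extend_left:
  assumes i: "Suc a \<le> i" "i \<le> b"
  defines "m \<equiv> \<lambda>x. avg x a b"
  shows "\<bar>maxmin a b i x - m x\<bar> \<le> \<bar>maxmin (Suc a) b i x - m x\<bar>"
proof -
  let ?z = "maxmin a b i x" and ?y = "maxmin (Suc a) b i x"
  have i': "a \<le> i" "i \<le> b" using i by auto
  have le: "?y \<le> ?z"
  proof (rule ccontr)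
    assume "\<not> ?y \<le> ?z"
    then obtain r where "r \<in> {Suc a..i}" "\<forall>s\<in>{i..b}. ?z < avg x r s"
      using less_maxmin_iff[OF i, of ?z x] by auto
    then have "?z < ?z" by (subst less_maxmin_iff[OF i']) auto
    then show False by simp
  qed
  have "?z \<le> m x" if "?y < ?z"
  proof (rule ccontr)
    assume "\<not> ?z \<le> m x"
    \<comment> \<open>With the larger of both bounds as threshold, one \<open>r\<close> beats both;
      \<open>r = a\<close> contradicts the mean and any other \<open>r\<close> contradicts
      \<open>?y\<close>.\<close>
    with that have "max ?y (m x) < ?z" by simp
    then obtain r where r: "r \<in> {a..i}" "\<forall>s\<in>{i..b}. max ?y (m x) < avg x r s"
      using less_maxmin_iff[OF i'] by blast
    show False
    proof (cases "r = a")
      case True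
      with r(2) i have "m x < avg x a b" by auto
      then show False by (simp add: m_def)
    next
      case False
      then have "?y < ?y" using r by (subst less_maxmin_iff[OF i]) auto
      then show False by simp
    qed
  qed
  with le show ?thesis by (cases "?z = ?y") auto
qed

lemma maxmin_singleton: "maxmin i i i x = x i"
  by (simp add: maxmin_def avg_def)

lemma maxmin_pair_right: "maxmin i (Suc i) i x = min (x i) (avg x i (Suc i))"
proof -
  have "{i..Suc i} = {i, Suc i}" by auto
  then show ?thesis by (simp add: maxmin_def avg_def)
qed

lemma maxmin_pair_left: "maxmin i (Suc i) (Suc i) x = max (x (Suc i)) (avg x i (Suc i))"
proof -
  have "{i..Suc i} = {i, Suc i}" by auto
  then show ?thesis by (simp add: maxmin_def avg_def max.commute)
qed

section \<open>Growing blocks of exchangeable Gaussian variables\<close>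

text \<open>The covariance is a multiple \<open>p\<close> of the identity minus a constant
  \<open>q\<close>, as on a tie set, where \<open>p\<close> is the common value of the cumulative
  incidence functions and \<open>q\<close> its square.\<close>

locale exchangeable_gaussian = prob_space N
  for N :: "'b measure" and X :: "nat \<Rightarrow> 'b \<Rightarrow> real" and I :: "nat set" and p q u :: real +
  assumes gauss: "gaussian_family N I X"
    and mean: "\<And>j. j \<in> I \<Longrightarrow> (LINT \<omega>|N. X j \<omega>) = 0"
    and second: "\<And>l j. l \<in> I \<Longrightarrow> j \<in> I \<Longrightarrow> (LINT \<omega>|N. X l \<omega> * X j \<omega>) = (if l = j then p else 0) - q"
    and p: "0 < p" and u: "0 < u"
begin

abbreviation W :: "nat \<Rightarrow> nat \<Rightarrow> nat \<Rightarrow> real" where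
  "W a b i \<equiv> measure N {\<omega> \<in> space N. \<bar>maxmin a b i (\<lambda>j. X j \<omega>)\<bar> \<le> u}"

text \<open>The general comparison is applied to the coordinates in [a, b], with the estimator on
  the inner block as \<open>f\<close> and the one on the whole block as \<open>f'\<close>.\<close>

lemma compare:
  assumes sub: "{a..b} \<subseteq> I" and ab: "a \<le> b"
    and ab': "{a'..b'} \<subseteq> {a..b}" "a' \<le> i" "i \<le> b'"
    and closer: "\<And>x. \<bar>maxmin a b i x - avg x a b\<bar> \<le> \<bar>maxmin a' b' i x - avg x a b\<bar>"
  shows compare_le: "W a' b' i \<le> W a b i"
    and compare_less: "0 < measure N {\<omega> \<in> space N. P \<omega>} \<Longrightarrow>
      (\<And>\<omega>. \<omega> \<in> space N \<Longrightarrow> P \<omega> \<Longrightarrow> maxmin a b i (\<lambda>j. X j \<omega>) = avg (\<lambda>j. X j \<omega>) a b \<and>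
         u < \<bar>maxmin a' b' i (\<lambda>j. X j \<omega>) - avg (\<lambda>j. X j \<omega>) a b\<bar>) \<Longrightarrow>
      W a' b' i < W a b i"
proof -
  have N: "prob_space N" by (rule prob_space_axioms)
  have I: "finite {a..b}" "{a..b} \<noteq> {}" using ab by auto
  have i: "a \<le> i" "i \<le> b" using ab' by auto
  have g: "gaussian_family N {a..b} X"
    using gauss sub unfolding gaussian_family_def by blast
  have m: "(LINT \<omega>|N. X j \<omega>) = 0" if "j \<in> {a..b}" for j using mean that sub by blast
  \<comment> \<open>This common row sum may be 0, in which case the block mean is
    degenerate.\<close>
  have row: "(\<Sum>l\<in>{a..b}. LINT \<omega>|N. X l \<omega> * X j \<omega>) = p - real (card {a..b}) * q"
    if "j \<in> {a..b}" for j
  proof -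
    have "(\<Sum>l\<in>{a..b}. LINT \<omega>|N. X l \<omega> * X j \<omega>) = (\<Sum>l\<in>{a..b}. (if l = j then p else 0) - q)"
      using sub that by (intro sum.cong second) auto
    then show ?thesis using that by (simp add: sum_subtractf)
  qed
  note * = g m row maxmin_measurable[OF ab'(1)] maxmin_measurable[OF subset_refl]
    maxmin_shift[OF ab'(2,3)] maxmin_shift[OF i] maxmin_restrict[OF ab'(1)] maxmin_restrict[OF subset_refl]
    closer[unfolded avg_eq_mean[OF ab]] u
  show "W a' b' i \<le> W a b i"
    by (rule gaussian_equivariant_comparison_le[OF N I *])
  show "W a' b' i < W a b i" if "0 < measure N {\<omega> \<in> space N. P \<omega>}"
    and "\<And>\<omega>. \<omega> \<in> space N \<Longrightarrow> P \<omega> \<Longrightarrow> maxmin a b i (\<lambda>j. X j \<omega>) = avg (\<lambda>j. X j \<omega>) a b \<and>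
         u < \<bar>maxmin a' b' i (\<lambda>j. X j \<omega>) - avg (\<lambda>j. X j \<omega>) a b\<bar>"
    by (rule gaussian_equivariant_comparison_less[OF N I * that(1)])
      (use that(2) in \<open>simp_all only: avg_eq_mean[OF ab]\<close>)
qed

text \<open>The block grows by one index per step, first on the right up to \<open>b\<close>, then
  on the left down to \<open>a\<close>.\<close>

lemma W_mono:
  assumes "{a..b} \<subseteq> I" "a \<le> a'" "a' \<le> i" "i \<le> b'" "b' \<le> b"
  shows "W a' b' i \<le> W a b i"
proof -
  have "W a' b' i \<le> W a' b i"
    using \<open>b' \<le> b\<close> assms(1)
  proof (induction rule: dec_induct)
    case (step n)
    have "W a' n i \<le> W a' (Suc n) i"
      using step assms by (intro compare_le maxmin_extend_right) auto
    moreover have "W a' b' i \<le> W a' n i"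
      using step.prems by (intro step.IH) auto
    ultimately show ?case by simp
  qed simp
  also have "W a' b i \<le> W a b i"
    using \<open>a \<le> a'\<close>
  proof (induction rule: inc_induct)
    case (step n)
    have "W (Suc n) b i \<le> W n b i"
      using step assms by (intro compare_le maxmin_extend_left) auto
    with step show ?case by simp
  qed simp
  finally show ?thesis .
qed

text \<open>The constant \<open>q\<close> cancels in the variance of a difference, which is
  \<open>2 * p\<close> and so positive.\<close>

lemma difference_exceeds:
  assumes "l \<in> I" "j \<in> I" "l \<noteq> j"
  shows "0 < measure N {\<omega> \<in> space N. c < X l \<omega> - X j \<omega>}"
proof -
  have N: "prob_space N" by (rule prob_space_axioms)
  have lin: "gaussian_rv N (\<lambda>\<omega>. \<Sum>h\<in>{l, j}. a h * X h \<omega>)" for a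
    using gauss assms unfolding gaussian_family_def by (metis empty_subsetI finite.emptyI finite.insertI insert_subset)
  have D: "gaussian_rv N (\<lambda>\<omega>. X l \<omega> - X j \<omega>)"
    using lin[of "\<lambda>h. if h = l then 1 else - 1"] assms(3) by simp
  have "gaussian_rv N (X l)" "gaussian_rv N (X j)"
    using lin[of "\<lambda>h. if h = l then 1 else 0"] lin[of "\<lambda>h. if h = j then 1 else 0"] assms(3) by simp_all
  note meas = this[THEN gaussian_rv_measurable] and L2 = this[THEN gaussian_rv_square_integrable[OF N]]
  have i: "integrable N (X l)" "integrable N (X j)" "integrable N (\<lambda>\<omega>. X l \<omega> * X j \<omega>)"
    using square_integrable_imp_integrable[OF meas(1) L2(1)] square_integrable_imp_integrable[OF meas(2) L2(2)]
      square_integrable_mult[OF meas L2] by blast+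
  have "(LINT \<omega>|N. (X l \<omega> - X j \<omega>)\<^sup>2) = (LINT \<omega>|N. (X l \<omega>)\<^sup>2 + (X j \<omega>)\<^sup>2 - 2 * (X l \<omega> * X j \<omega>))"
    by (intro Bochner_Integration.integral_cong) (auto simp: power2_diff)
  also have "\<dots> = 2 * p"
    using L2 i second[of l l] second[of j j] second[of l j] assms by (simp add: power2_eq_square)
  finally show ?thesis
    using mean assms i p by (intro gaussian_rv_tail_pos[OF N D]) auto
qed

text \<open>Passing from \<open>i\<close> alone to a pair is strict, and all further growth is
  covered by \<open>W_mono\<close>. The partner is the right neighbour, or the left one when
  \<open>i\<close> is the last index.\<close>

lemma W_less:
  assumes "{a..b} \<subseteq> I" "a \<le> i" "i \<le> b" "a < b"
  shows "measure N {\<omega> \<in> space N. \<bar>X i \<omega>\<bar> \<le> u} < W a b i"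
proof (cases "i < b")
  case True
  have "W i i i < W i (Suc i) i"
  proof (rule compare_less)
    \<comment> \<open>Each member of a pair lies half the difference away from the pair mean, hence
      the factor 2. As the pair is in decreasing order, the estimator pools it and returns the
      mean.\<close>
    show "0 < measure N {\<omega> \<in> space N. 2 * u < X i \<omega> - X (Suc i) \<omega>}"
      using assms True by (intro difference_exceeds) auto
    show "maxmin i (Suc i) i (\<lambda>j. X j \<omega>) = avg (\<lambda>j. X j \<omega>) i (Suc i) \<and>
      u < \<bar>maxmin i i i (\<lambda>j. X j \<omega>) - avg (\<lambda>j. X j \<omega>) i (Suc i)\<bar>"
      if "2 * u < X i \<omega> - X (Suc i) \<omega>" for \<omega>
      using that u unfolding maxmin_singleton maxmin_pair_right by (auto simp: avg_def field_simps min_def)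
  qed (use assms True maxmin_extend_right[of i i i] in auto)
  also have "\<dots> \<le> W a b i" using assms True by (intro W_mono) auto
  finally show ?thesis by (simp add: maxmin_singleton)
next
  case False
  then obtain h where h: "i = Suc h" "i = b" "a \<le> h" using assms by (cases i) auto
  have "W i i i < W h (Suc h) i"
  proof (rule compare_less)
    show "0 < measure N {\<omega> \<in> space N. 2 * u < X h \<omega> - X i \<omega>}"
      using assms h by (intro difference_exceeds) auto
    show "maxmin h (Suc h) i (\<lambda>j. X j \<omega>) = avg (\<lambda>j. X j \<omega>) h (Suc h) \<and>
      u < \<bar>maxmin i i i (\<lambda>j. X j \<omega>) - avg (\<lambda>j. X j \<omega>) h (Suc h)\<bar>"
      if "2 * u < X h \<omega> - X i \<omega>" for \<omega>
      using that u unfolding h(1) maxmin_singleton maxmin_pair_left by (auto simp: avg_def field_simps max_def)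
  qed (use assms h maxmin_extend_left[of h i i] in auto)
  also have "\<dots> \<le> W a b i" using assms h by (intro W_mono) auto
  finally show ?thesis by (simp add: maxmin_singleton)
qed

end

section \<open>The tie set and the final inequality\<close>

text \<open>A level set of a monotone sequence has no gaps. Hence all indices between the extremes
  used in \<open>Z_star\<close> belong to the tie set and share one covariance structure.\<close>

lemma tie_set_eq_interval:
  assumes mono: "\<And>l. l \<in> {1..<k} \<Longrightarrow> F l t \<le> F (Suc l) t" and i: "i \<in> {1..k}"
  defines "S \<equiv> tie_set k F i t"
  shows "S = {Min S..Max S}" "i \<in> S" "S \<subseteq> {1..k}"
proof -
  show iS: "i \<in> S" and sub: "S \<subseteq> {1..k}" using i by (auto simp: S_def tie_set_def)
  have fin: "finite S" using sub finite_subset by blast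
  have le: "F l t \<le> F j t" if "l \<le> j" "1 \<le> l" "j \<le> k" for l j
    using that
  proof (induction rule: dec_induct)
    case (step n)
    then show ?case using mono[of n] by auto
  qed simp
  have "Min S \<in> S" "Max S \<in> S" using fin iS by (auto intro: Min_in Max_in)
  then have "F (Min S) t = F i t" "F (Max S) t = F i t" "1 \<le> Min S" "Max S \<le> k"
    by (auto simp: S_def tie_set_def)
  then have "j \<in> S" if "j \<in> {Min S..Max S}" for j
    using le[of "Min S" j] le[of j "Max S"] that by (auto simp: S_def tie_set_def)
  then have "{Min S..Max S} \<subseteq> S" by blast
  moreover have "S \<subseteq> {Min S..Max S}" using fin by auto
  ultimately show "S = {Min S..Max S}" by (rule equalityI[rotated])
qed

theorem theorem4p1:
  fixes M :: "'a measure" and T :: "'a \<Rightarrow> real" and \<delta> :: "'a \<Rightarrow> nat" and k :: nat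
    and N :: "'b measure" and Z :: "nat \<Rightarrow> real \<Rightarrow> 'b \<Rightarrow> real"
    and F :: "nat \<Rightarrow> real \<Rightarrow> real" and c d :: "nat \<Rightarrow> ereal"
    and i :: nat and t :: real and u :: real
  defines "F \<equiv> cif M T \<delta>"
    and "c \<equiv> \<lambda>l. left_endpoint (F l)"
    and "d \<equiv> \<lambda>l. right_endpoint (F l)"
  assumes model: "competing_risks M T \<delta> k"
    and N: "prob_space N"
    and Z_gaussian: "gaussian_process N k Z"
    and Z_mean: "\<And>l s. l \<in> {1..k} \<Longrightarrow> 0 \<le> s \<Longrightarrow> (LINT \<omega>|N. Z l s \<omega>) = 0"
    and Z_cov: "\<And>l j s s'. l \<in> {1..k} \<Longrightarrow> j \<in> {1..k} \<Longrightarrow> 0 \<le> s \<Longrightarrow> s \<le> s' \<Longrightarrow>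
      cov N (Z l s) (Z j s') = F l s * ((if l = j then 1 else 0) - F j s')"
    and ordered: "\<And>l s. l \<in> {1..<k} \<Longrightarrow> 0 \<le> s \<Longrightarrow> F l s \<le> F (Suc l) s"
    and separated: "\<And>l j \<eta>. l \<in> {1..k - 1} \<Longrightarrow> j \<in> {1..k} \<Longrightarrow>
      j > Max {m \<in> {1..k}. \<forall>s\<ge>0. F m s = F l s} \<Longrightarrow> 0 < (\<eta> :: real) \<Longrightarrow>
      0 < (INF s\<in>{s. 0 \<le> s \<and> c l + ereal \<eta> \<le> ereal s \<and> ereal s \<le> d l - ereal \<eta>}.
             ereal (F j s - F l s))"
    and i: "i \<in> {1..k}"
    and t: "0 \<le> t" "0 < F i t" "F i t < 1"
    and ties: "card (tie_set k F i t) > 1"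
    and u: "0 < u"
  shows "measure N {\<omega> \<in> space N. \<bar>Z_star k F Z i t \<omega>\<bar> \<le> u} >
         measure N {\<omega> \<in> space N. \<bar>Z i t \<omega>\<bar> \<le> u}"
proof -
  define S where "S = tie_set k F i t"
  note S = tie_set_eq_interval[of k F t i, OF ordered[OF _ t(1)] i, folded S_def]
  have FS: "F j t = F i t" if "j \<in> S" for j using that by (simp add: S_def tie_set_def)
  interpret exchangeable_gaussian N "\<lambda>j. Z j t" S "F i t" "(F i t)\<^sup>2" u
  proof (intro exchangeable_gaussian.intro exchangeable_gaussian_axioms.intro N)
    show "gaussian_family N S (\<lambda>j. Z j t)"
      unfolding gaussian_family_def
    proof (intro allI impI)
      fix J :: "nat set" and a :: "nat \<Rightarrow> real" assume J: "finite J" "J \<subseteq> S"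
      \<comment> \<open>The process is indexed by pairs of a risk and a time, so the fixed time
        \<open>t\<close> enters through the image of \<open>J\<close>.\<close>
      have "gaussian_rv N (\<lambda>\<omega>. \<Sum>z\<in>(\<lambda>j. (j, t)) ` J. a (fst z) * (case z of (j, t) \<Rightarrow> Z j t) \<omega>)"
        using Z_gaussian[unfolded gaussian_process_def gaussian_family_def, rule_format,
            of "(\<lambda>j. (j, t)) ` J" "\<lambda>z. a (fst z)"] J S(3) t(1) by force
      then show "gaussian_rv N (\<lambda>\<omega>. \<Sum>j\<in>J. a j * Z j t \<omega>)"
        by (simp add: sum.reindex inj_on_def)
    qed
    show "(LINT \<omega>|N. Z l t \<omega> * Z j t \<omega>) = (if l = j then F i t else 0) - (F i t)\<^sup>2"
      if "l \<in> S" "j \<in> S" for l j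
    proof -
      have "l \<in> {1..k}" "j \<in> {1..k}" using that S(3) by auto
      then show ?thesis
        using Z_cov[of l j t t] Z_mean[of l t] Z_mean[of j t] FS that t(1)
        by (simp add: cov_def power2_eq_square right_diff_distrib)
    qed
  qed (use Z_mean S(3) t u in auto)
  have "finite S" using S(3) finite_subset by blast
  \<comment> \<open>A tie of at least two indices leaves room for the strict first enlargement in
    \<open>W_less\<close>.\<close>
  have "Min S < Max S"
  proof (rule ccontr)
    assume "\<not> Min S < Max S"
    then have "card {Min S..Max S} \<le> 1" by simp
    with ties S(1) show False by (simp add: S_def)
  qed
  moreover have "Min S \<le> i" "i \<le> Max S" using S(2) \<open>finite S\<close> by auto
  ultimately show ?thesis
    using W_less[of "Min S" "Max S" i] S(1)
    unfolding Z_star_def maxmin_def avg_def S_def[symmetric] by simp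
qed

end
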